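(* Let $G=(V,E)$ be a ribbon graph, let $A\subseteq E$ and let $k$ be a non-negative integer. Then $D_{\leq k}(G^A)=D_{\leq k}(G)*A$ and, in particular, $D(G^A)=D(G)*A$. Furthermore, if $G$ is orientable, then $D_1(G^A)=D_1(G)*A$.
   Context: A ribbon graph $G=(V,E)$ is a surface with boundary, represented as the union of two finite sets of discs, the vertices $V$ and the edges $E$, such that: the vertices and edges intersect in disjoint line segments; each such line segment lies on the boundary of precisely one vertex and precisely one edge; every edge contains exactly two such line segments. $G$ is orientable if it is orientable as a surface. For $A\subseteq E$, $f_G(A)$ denotes the number of boundary components of the spanning ribbon subgraph $(V,A)$, and $k(G)$ denotes the number of connected components of $G$. For a non-negative integer $n$, $D_{\leq n}(G)$ is the set system on $E$ whose feasible sets are the $B\subseteq E$ with $f_G(B)\leq k(G)+n$; $D_n(G)$ is the set system on $E$ whose feasible sets are the $B\subseteq E$ with $f_G(B)=k(G)+n$; and $D(G)=D_0(G)=D_{\leq 0}(G)$ (its feasible sets are the edge sets of the spanning quasi-trees of $G$). Partial dual: for $A\subseteq E$, regard the boundary components of $(V,A)$ as curves on the surface of $G$, glue a disc to $G$ along each of these curves, and remove the interior of all vertices of $G$. The resulting ribbon graph, whose vertices are the glued discs and whose edges are identified with those of $G$, is $G^A$. Twist: for a set system $D=(E,\mathcal{F})$ and $A\subseteq E$, $D*A=(E,\{A\bigtriangleup X\mid X\in\mathcal{F}\})$. *)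

theory Defs
  imports "HOL-Analysis.Analysis"
begin

section \<open>Surfaces with boundary\<close>

text \<open>
  Surfaces are abstract topologies. The plane is \<^typ>\<open>complex\<close>. In a surface with boundary, the
  boundary points are exactly those without a neighbourhood homeomorphic to the plane.
\<close>

definition surface_boundary :: "'p topology \<Rightarrow> 'p set" where
  "surface_boundary X =
     {x \<in> topspace X. \<not> (\<exists>U. openin X U \<and> x \<in> U \<and>
        subtopology X U homeomorphic_space (euclidean :: complex topology))}"

definition is_disc :: "'p topology \<Rightarrow> 'p set \<Rightarrow> bool" where
  "is_disc X D \<longleftrightarrow> D \<subseteq> topspace X \<and>
     subtopology X D homeomorphic_space top_of_set (cball (0::complex) 1)"

definition is_segment :: "'p topology \<Rightarrow> 'p set \<Rightarrow> bool" where
  "is_segment X l \<longleftrightarrow> l \<subseteq> topspace X \<and>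
     subtopology X l homeomorphic_space top_of_set {0..1::real}"

abbreviation disc_boundary :: "'p topology \<Rightarrow> 'p set \<Rightarrow> 'p set" where
  "disc_boundary X D \<equiv> surface_boundary (subtopology X D)"

definition disc_interior :: "'p topology \<Rightarrow> 'p set \<Rightarrow> 'p set" where
  "disc_interior X D = D - disc_boundary X D"

text \<open>
  The Moebius band is the quotient of the unit square that identifies \<open>(0, t)\<close> with \<open>(1, 1 - t)\<close>.
  A surface is orientable if it contains no Moebius band.
\<close>

abbreviation unit_square :: "(real \<times> real) set" where
  "unit_square \<equiv> {0..1} \<times> {0..1}"

definition moebius_ident :: "real \<times> real \<Rightarrow> real \<times> real \<Rightarrow> bool" where
  "moebius_ident x y \<longleftrightarrow> fst x = 0 \<and> fst y = 1 \<and> snd y = 1 - snd x"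

definition is_moebius_band :: "'p topology \<Rightarrow> 'p set \<Rightarrow> bool" where
  "is_moebius_band X M \<longleftrightarrow> M \<subseteq> topspace X \<and>
     (\<exists>g. quotient_map (top_of_set unit_square) (subtopology X M) g \<and>
        (\<forall>x \<in> unit_square. \<forall>y \<in> unit_square.
           g x = g y \<longleftrightarrow> x = y \<or> moebius_ident x y \<or> moebius_ident y x))"

definition orientable_surface :: "'p topology \<Rightarrow> bool" where
  "orientable_surface X \<longleftrightarrow> \<not> (\<exists>M. is_moebius_band X M)"


section \<open>Ribbon graphs\<close>

text \<open>
  \<open>'p\<close> is the type of points of the surface. Vertices are discs in the surface. Edges are labels
  \<open>e\<close> with an associated disc \<open>band G e\<close>, so that different ribbon graphs can have the same edge set.
\<close>

record ('p, 'e) ribbon =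
  surf :: "'p topology"
  verts :: "'p set set"
  edges :: "'e set"
  band :: "'e \<Rightarrow> 'p set"

text \<open>
  The family \<open>L\<close> consists of the line segments in which vertices and edges meet. A Hausdorff space
  that is a finite union of discs carries the topology obtained by gluing these discs, and since
  they are glued along disjoint boundary segments it is a compact surface with boundary.
\<close>

definition ribbon_graph :: "('p, 'e) ribbon \<Rightarrow> bool" where
  "ribbon_graph G \<longleftrightarrow>
     Hausdorff_space (surf G) \<and>
     finite (verts G) \<and> finite (edges G) \<and>
     topspace (surf G) = \<Union>(verts G) \<union> \<Union>(band G ` edges G) \<and>
     (\<forall>v \<in> verts G. is_disc (surf G) v) \<and>
     (\<forall>e \<in> edges G. is_disc (surf G) (band G e)) \<and>
     pairwise disjnt (verts G) \<and>
     disjoint_family_on (band G) (edges G) \<and>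
     (\<exists>L. pairwise disjnt L \<and>
        \<Union>(verts G) \<inter> \<Union>(band G ` edges G) = \<Union>L \<and>
        (\<forall>l \<in> L. is_segment (surf G) l \<and>
           (\<exists>!v. v \<in> verts G \<and> l \<subseteq> disc_boundary (surf G) v) \<and>
           (\<exists>!e. e \<in> edges G \<and> l \<subseteq> disc_boundary (surf G) (band G e))) \<and>
        (\<forall>e \<in> edges G. card {l \<in> L. l \<subseteq> band G e} = 2))"

definition orientable :: "('p, 'e) ribbon \<Rightarrow> bool" where
  "orientable G \<longleftrightarrow> orientable_surface (surf G)"

definition num_components :: "('p, 'e) ribbon \<Rightarrow> nat" where
  "num_components G = card (connected_components_of (surf G))"

definition spanning_subgraph :: "('p, 'e) ribbon \<Rightarrow> 'e set \<Rightarrow> ('p, 'e) ribbon" where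
  "spanning_subgraph G B =
     G\<lparr>surf := subtopology (surf G) (\<Union>(verts G) \<union> \<Union>(band G ` B)), edges := B\<rparr>"

definition boundary_components :: "('p, 'e) ribbon \<Rightarrow> 'p set set" where
  "boundary_components G =
     connected_components_of (subtopology (surf G) (surface_boundary (surf G)))"

definition num_boundary :: "('p, 'e) ribbon \<Rightarrow> 'e set \<Rightarrow> nat" where
  "num_boundary G B = card (boundary_components (spanning_subgraph G B))"


section \<open>Partial duals\<close>

text \<open>
  The partial dual is determined up to homeomorphism, so it is a relation: \<open>H\<close> is a partial dual
  of \<open>G\<close> with respect to \<open>A\<close>. The space \<open>S\<close> is \<open>G\<close> (embedded by \<open>i\<close>) with a disc \<open>d C\<close> glued along
  each boundary component \<open>C\<close> of the spanning ribbon subgraph with edge set \<open>A\<close>. Removing the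
  interiors of the vertices of \<open>G\<close> from \<open>S\<close> leaves \<open>H\<close> (embedded by \<open>j\<close>). The sum type has enough
  points for such an \<open>S\<close> whatever the point types of \<open>G\<close> and \<open>H\<close>, so the relation is invariant
  under homeomorphism.
\<close>

definition partial_dual :: "('p, 'e) ribbon \<Rightarrow> 'e set \<Rightarrow> ('q, 'e) ribbon \<Rightarrow> bool" where
  "partial_dual G A H \<longleftrightarrow>
     ribbon_graph H \<and> edges H = edges G \<and>
     (\<exists>(S :: ('p + 'q) topology) i j d.
        let \<C> = boundary_components (spanning_subgraph G A) in
        Hausdorff_space S \<and>
        embedding_map (surf G) S i \<and>
        topspace S = i ` topspace (surf G) \<union> \<Union>(d ` \<C>) \<and>
        (\<forall>C \<in> \<C>. is_disc S (d C) \<and> disc_boundary S (d C) = i ` C \<and>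
           d C \<inter> i ` topspace (surf G) = i ` C) \<and>
        disjoint_family_on d \<C> \<and>
        embedding_map (surf H) S j \<and>
        j ` topspace (surf H) =
          topspace S - i ` (\<Union>v \<in> verts G. disc_interior (surf G) v) \<and>
        (`) j ` verts H = d ` \<C> \<and>
        (\<forall>e \<in> edges G. j ` band H e = i ` band G e))"


section \<open>Set systems\<close>

text \<open>A set system is a pair of a ground set and its family of feasible sets.\<close>

type_synonym 'e set_system = "'e set \<times> 'e set set"

definition twist :: "'e set_system \<Rightarrow> 'e set \<Rightarrow> 'e set_system" where
  "twist D A = (fst D, {sym_diff A X | X. X \<in> snd D})"

definition D_le :: "nat \<Rightarrow> ('p, 'e) ribbon \<Rightarrow> 'e set_system" where
  "D_le n G = (edges G, {B. B \<subseteq> edges G \<and> num_boundary G B \<le> num_components G + n})"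

definition D_eq :: "nat \<Rightarrow> ('p, 'e) ribbon \<Rightarrow> 'e set_system" where
  "D_eq n G = (edges G, {B. B \<subseteq> edges G \<and> num_boundary G B = num_components G + n})"

definition D_ribbon :: "('p, 'e) ribbon \<Rightarrow> 'e set_system" where
  "D_ribbon G = D_eq 0 G"

end

theory Submission
  imports Defs
begin

text \<open>
  For every set \<open>B\<close> of edges, the spanning subgraph of the partial dual \<open>H\<close> with edge set \<open>B\<close> and the
  spanning subgraph of \<open>G\<close> whose edge set is the symmetric difference of \<open>A\<close> and \<open>B\<close> have the same
  boundary, as sets of points in the space \<open>S\<close> from which \<open>H\<close> is cut out. Also \<open>G\<close> and \<open>H\<close> have the
  same number of components. The set systems in question only depend on these two invariants.

  The boundaries are equal for the following reason. A surface that is glued from two families of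
  disjoint discs, vertices and bands, has as its boundary the closure of the symmetric difference of
  the vertex circles and the band circles (\<open>surface_boundary_discs\<close>): a point on exactly one circle is a
  boundary point, a point inside an arc of attachment is an interior point, and the closure
  accounts for the corners. By construction, the vertex circles of \<open>H\<close> form the boundary of the spanning
  subgraph of \<open>G\<close> with edge set \<open>A\<close>. They are therefore, up to corners, the vertex circles of \<open>G\<close> plus the
  band circles for \<open>A\<close>, where plus is the symmetric difference. Adding the band circles for \<open>B\<close> gives, on
  the one hand, the boundary of the subgraph of \<open>H\<close> and, on the other hand, the vertex circles of \<open>G\<close>
  plus the band circles for the symmetric difference of \<open>A\<close> and \<open>B\<close>. That corners can be added or left
  out is \<open>closure_sym_diff_boundary_curves\<close>.

  The topology of the plane enters through invariance of domain. It shows that the boundary of a disc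
  is a circle, and that two circles sharing an arc leave it at the same points.

  The numbers of components agree because \<open>S\<close> arises both from \<open>G\<close> and from \<open>H\<close> by attaching discs
  along their boundary circles, and circles are connected (\<open>card_components_attached_discs\<close>).
\<close>

section \<open>Boundary points of surfaces and discs\<close>

definition planar_at :: "'a topology \<Rightarrow> 'a \<Rightarrow> bool" where
  "planar_at X x \<longleftrightarrow> (\<exists>U. openin X U \<and> x \<in> U \<and>
     subtopology X U homeomorphic_space (euclidean :: complex topology))"

lemma surface_boundary_eq: "surface_boundary X = {x \<in> topspace X. \<not> planar_at X x}"
  by (simp add: surface_boundary_def planar_at_def)

lemma homeomorphism_imp_homeomorphic_maps:
  "homeomorphism S T f g \<Longrightarrow> homeomorphic_maps (top_of_set S) (top_of_set T) f g"
  by (auto simp: homeomorphic_maps_def homeomorphism_def continuous_map_in_subtopology)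

text \<open>
  A neighbourhood homeomorphic to an arbitrary open set of the plane suffices, because it contains
  a round disc about the image of the point, and open round discs are homeomorphic to the plane.
\<close>

lemma planar_atI:
  fixes f :: "'a \<Rightarrow> complex"
  assumes U: "openin X U" "x \<in> U" and T: "open T"
    and f: "homeomorphic_map (subtopology X U) (top_of_set T) f"
  shows "planar_at X x"
proof -
  have topU: "topspace (subtopology X U) = U"
    using U(1) openin_subset by (metis topspace_subtopology_subset)
  have fim: "f ` U = T"
    using homeomorphic_imp_surjective_map[OF f] topU by simp
  then obtain r where r: "r > 0" "ball (f x) r \<subseteq> T"
    using T U(2) open_contains_ball by blast
  let ?V = "{y \<in> U. f y \<in> ball (f x) r}"
  have "openin (subtopology X U) {y \<in> topspace (subtopology X U). f y \<in> ball (f x) r}"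
    using r T
    by (intro openin_continuous_map_preimage[OF homeomorphic_imp_continuous_map[OF f]])
       (simp add: openin_open_eq)
  then have V: "openin X ?V"
    unfolding topU using U(1) by (meson openin_trans_full)
  have "subtopology (subtopology X U) ?V = subtopology X ?V"
    by (simp add: subtopology_subtopology inf.absorb2)
  moreover have "subtopology (top_of_set T) (ball (f x) r) = top_of_set (ball (f x) r)"
    using r(2) by (simp add: subtopology_subtopology inf.absorb2)
  moreover have "homeomorphic_map (subtopology (subtopology X U) ?V)
      (subtopology (top_of_set T) (ball (f x) r)) f"
    using topU by (intro homeomorphic_map_subtopologies_alt[OF f]) auto
  ultimately have "homeomorphic_map (subtopology X ?V) (top_of_set (ball (f x) r)) f"
    by (simp only:)
  then have "subtopology X ?V homeomorphic_space top_of_set (ball (f x) r)"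
    by (rule homeomorphic_map_imp_homeomorphic_space)
  also have "top_of_set (ball (f x) r) homeomorphic_space (euclidean :: complex topology)"
  proof -
    obtain p q where "homeomorphism (ball (f x) r) (UNIV :: complex set) p q"
      using homeomorphic_ball_UNIV[OF r(1), of "f x"] unfolding homeomorphic_def by (elim exE)
    then have "homeomorphic_maps (top_of_set (ball (f x) r)) euclidean p q"
      using homeomorphism_imp_homeomorphic_maps[of "ball (f x) r" UNIV p q] by (simp only: subtopology_UNIV)
    then show ?thesis
      unfolding homeomorphic_space_def by blast
  qed
  finally show ?thesis
    unfolding planar_at_def using V U(2) r(1) by (intro exI[of _ ?V]) simp
qed

lemma planar_at_open_subtopology:
  assumes W: "openin X W" "x \<in> W"
  shows "planar_at (subtopology X W) x \<longleftrightarrow> planar_at X x"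
proof
  assume "planar_at (subtopology X W) x"
  then obtain U where U: "openin (subtopology X W) U" "x \<in> U"
      "subtopology (subtopology X W) U homeomorphic_space (euclidean :: complex topology)"
    unfolding planar_at_def by blast
  then have "openin X U" "U \<subseteq> W"
    using W by (auto simp: openin_open_subtopology)
  with U show "planar_at X x"
    unfolding planar_at_def by (auto simp: subtopology_subtopology inf.absorb2)
next
  assume "planar_at X x"
  then obtain U f where U: "openin X U" "x \<in> U"
    and f: "homeomorphic_map (subtopology X U) (euclidean :: complex topology) f"
    unfolding planar_at_def by (meson homeomorphic_space)
  have UW: "openin X (U \<inter> W)"
    using U W by blast
  have topU: "topspace (subtopology X U) = U"
    using U(1) openin_subset by (metis topspace_subtopology_subset)
  have "open (f ` (U \<inter> W))"
    using homeomorphic_imp_open_map[OF f] UW U(1)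
    by (auto simp: open_map_def openin_open_subtopology)
  moreover have "homeomorphic_map (subtopology (subtopology X U) (U \<inter> W))
      (subtopology euclidean (f ` (U \<inter> W))) f"
    using topU by (intro homeomorphic_map_subtopologies[OF f]) auto
  then have "homeomorphic_map (subtopology (subtopology X W) (U \<inter> W)) (top_of_set (f ` (U \<inter> W))) f"
    by (simp add: subtopology_subtopology Int_ac)
  ultimately show "planar_at (subtopology X W) x"
    using UW U(2) W by (intro planar_atI[of _ "U \<inter> W"]) (auto simp: openin_open_subtopology)
qed

text \<open>
  Being a boundary point is a local property. This is how a point of a glued space that lies away
  from all but one or two of the discs is studied inside the union of those discs.
\<close>

lemma surface_boundary_local:
  assumes "openin X W" "x \<in> W" "W \<subseteq> D"
  shows "x \<in> surface_boundary X \<longleftrightarrow> x \<in> surface_boundary (subtopology X D)"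
proof -
  have W: "openin (subtopology X D) W" "subtopology (subtopology X D) W = subtopology X W"
    using assms by (auto simp: subset_openin_subtopology subtopology_subtopology inf.absorb2)
  have "x \<in> topspace X" "x \<in> D"
    using assms openin_subset by blast+
  then show ?thesis
    using planar_at_open_subtopology[OF assms(1,2)] planar_at_open_subtopology[OF W(1) assms(2)] W(2)
    by (simp add: surface_boundary_eq)
qed

lemma closedin_surface_boundary: "closedin X (surface_boundary X)"
proof -
  have "topspace X - surface_boundary X =
      \<Union>{U. openin X U \<and> subtopology X U homeomorphic_space (euclidean :: complex topology)}"
    using openin_subset by (fastforce simp: surface_boundary_def)
  moreover have "openin X \<dots>"
    by (rule openin_Union) blast
  ultimately show ?thesis
    by (auto simp: closedin_def surface_boundary_def)
qed

lemma surface_boundary_subset: "surface_boundary X \<subseteq> topspace X"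
  by (auto simp: surface_boundary_def)

lemma surface_boundary_homeomorphic_map:
  assumes f: "homeomorphic_map X Y f"
  shows "surface_boundary Y = f ` surface_boundary X"
proof -
  have planar: "planar_at Y (g x)"
    if g: "homeomorphic_map X Y g" and x: "planar_at X x"
    for X :: "'c topology" and Y :: "'d topology" and g x
  proof -
    obtain U where U: "openin X U" "x \<in> U"
      and hom: "subtopology X U homeomorphic_space (euclidean :: complex topology)"
      using x unfolding planar_at_def by blast
    have "homeomorphic_map (subtopology X U) (subtopology Y (g ` U)) g"
      using openin_subset[OF U(1)] homeomorphic_imp_surjective_map[OF g]
      by (intro homeomorphic_map_subtopologies[OF g]) auto
    then have "subtopology Y (g ` U) homeomorphic_space (euclidean :: complex topology)"
      using hom homeomorphic_map_imp_homeomorphic_space homeomorphic_space_sym homeomorphic_space_trans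
      by blast
    then show ?thesis
      unfolding planar_at_def
      using U homeomorphic_imp_open_map[OF g] by (auto simp: open_map_def)
  qed
  obtain g where g: "homeomorphic_maps X Y f g"
    using f homeomorphic_map_maps by blast
  then have gm: "homeomorphic_map Y X g" and gf: "\<And>x. x \<in> topspace X \<Longrightarrow> g (f x) = x"
    and im: "f ` topspace X = topspace Y"
    using homeomorphic_imp_surjective_map[OF f]
    by (auto simp: homeomorphic_maps_map)
  have "planar_at Y (f x) \<longleftrightarrow> planar_at X x" if "x \<in> topspace X" for x
    using planar[OF f, of x] planar[OF gm, of "f x"] gf[OF that] by auto
  then show ?thesis
    unfolding surface_boundary_eq using im by (auto simp flip: im)
qed

lemma embedding_map_subtopology:
  assumes "embedding_map X S f" "D \<subseteq> topspace X"
  shows "homeomorphic_map (subtopology X D) (subtopology S (f ` D)) f"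
proof -
  have f: "homeomorphic_map X (subtopology S (f ` topspace X)) f"
    using assms by (simp add: embedding_map_def)
  have "homeomorphic_map (subtopology X D) (subtopology (subtopology S (f ` topspace X)) (f ` D)) f"
    using assms(2) homeomorphic_imp_surjective_map[OF f, symmetric]
    by (intro homeomorphic_map_subtopologies[OF f]) auto
  then show ?thesis
    using assms(2) by (simp add: subtopology_subtopology inf.absorb2 image_mono)
qed

lemma disc_boundary_embedding:
  assumes "embedding_map X S f" "D \<subseteq> topspace X"
  shows "disc_boundary S (f ` D) = f ` disc_boundary X D"
  using surface_boundary_homeomorphic_map[OF embedding_map_subtopology[OF assms]] .

lemma is_disc_embedding:
  assumes f: "embedding_map X S f" and D: "is_disc X D"
  shows "is_disc S (f ` D)"
proof -
  have "D \<subseteq> topspace X"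
    using D by (simp add: is_disc_def)
  moreover have "f ` topspace X \<subseteq> topspace S"
    using f homeomorphic_imp_surjective_map[of X "subtopology S (f ` topspace X)" f]
    unfolding embedding_map_def by auto
  ultimately show ?thesis
    using D homeomorphic_map_imp_homeomorphic_space[OF embedding_map_subtopology[OF f]]
    unfolding is_disc_def by (meson homeomorphic_space_sym homeomorphic_space_trans image_mono subset_trans)
qed

text \<open>
  An open subset of the closed disc that is homeomorphic to the plane is open in the plane by
  invariance of domain, so it does not meet the unit circle.
\<close>

lemma surface_boundary_cball: "surface_boundary (top_of_set (cball (0::complex) 1)) = sphere 0 1"
proof -
  have "planar_at (top_of_set (cball (0::complex) 1)) x \<longleftrightarrow> x \<in> ball 0 1"
    if "x \<in> cball 0 1" for x
  proof
    assume "planar_at (top_of_set (cball (0::complex) 1)) x"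
    then obtain U where U: "openin (top_of_set (cball (0::complex) 1)) U" "x \<in> U"
      and hom: "subtopology (top_of_set (cball (0::complex) 1)) U homeomorphic_space (euclidean :: complex topology)"
      unfolding planar_at_def by blast
    have sub: "U \<subseteq> cball 0 1"
      using openin_subset[OF U(1)] by simp
    then have "subtopology (top_of_set (cball (0::complex) 1)) U = top_of_set U"
      by (simp add: subtopology_subtopology inf.absorb2)
    then obtain f g where fg: "homeomorphic_maps (euclidean :: complex topology) (top_of_set U) f g"
      using hom homeomorphic_space_sym unfolding homeomorphic_space_def by metis
    have "continuous_map euclidean (top_of_set U) f" "\<And>z. g (f z) = z"
      using fg by (auto simp: homeomorphic_maps_def)
    then have "continuous_on UNIV f" "inj f"
      by (auto simp: continuous_map_in_subtopology intro: inj_on_inverseI)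
    moreover have "f ` UNIV = U"
      using homeomorphic_imp_surjective_map[of euclidean "top_of_set U" f] fg
      by (simp add: homeomorphic_maps_map)
    ultimately have "open U"
      using invariance_of_domain[of UNIV f] by simp
    then have "U \<subseteq> interior (cball 0 1)"
      using sub interior_maximal by blast
    then show "x \<in> ball 0 1"
      using U(2) by auto
  next
    assume "x \<in> ball 0 1"
    moreover have "subtopology (top_of_set (cball 0 1)) (ball 0 1) = top_of_set (ball (0::complex) 1)"
      by (simp add: subtopology_subtopology inf.absorb2)
    ultimately show "planar_at (top_of_set (cball 0 1)) x"
      by (intro planar_atI[of _ "ball 0 1" _ "ball 0 1" id]) (auto simp: openin_open)
  qed
  then show ?thesis
    by (auto simp: surface_boundary_eq)
qed

text \<open>
  A chart of a disc that also identifies its boundary with the unit circle. All computations with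
  discs are done in such charts.
\<close>

lemma disc_chart:
  assumes "is_disc X D"
  obtains h g where "homeomorphic_maps (subtopology X D) (top_of_set (cball (0::complex) 1)) h g"
    "disc_boundary X D = {x \<in> D. norm (h x) = 1}"
    "homeomorphic_map (subtopology X (disc_boundary X D)) (top_of_set (sphere 0 1)) h"
proof -
  obtain h g where hg: "homeomorphic_maps (subtopology X D) (top_of_set (cball (0::complex) 1)) h g"
    using assms unfolding is_disc_def homeomorphic_space_def by blast
  have "sphere 0 1 = h ` disc_boundary X D"
    using surface_boundary_homeomorphic_map[of "subtopology X D" "top_of_set (cball 0 1)" h] hg
    by (simp add: homeomorphic_maps_map surface_boundary_cball)
  moreover have "inj_on h (topspace (subtopology X D))"
    using hg homeomorphic_imp_injective_map homeomorphic_maps_map by blast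
  moreover have "topspace (subtopology X D) = D"
    using assms by (auto simp: is_disc_def)
  ultimately have "x \<in> disc_boundary X D \<longleftrightarrow> h x \<in> sphere 0 1" if "x \<in> D" for x
    using that surface_boundary_subset[of "subtopology X D"] 
    by (metis inj_on_image_mem_iff)
  then have bd: "disc_boundary X D = {x \<in> D. norm (h x) = 1}"
    using surface_boundary_subset[of "subtopology X D"] by auto
  have h: "homeomorphic_map (subtopology X D) (top_of_set (cball 0 1)) h"
    using hg by (simp add: homeomorphic_maps_map)
  have "homeomorphic_map (subtopology (subtopology X D) (disc_boundary X D))
      (subtopology (top_of_set (cball 0 1)) (sphere 0 1)) h"
    by (intro homeomorphic_map_subtopologies_alt[OF h]) (auto simp: bd)
  moreover have "disc_boundary X D \<subseteq> D"
    by (auto simp: bd)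
  ultimately have "homeomorphic_map (subtopology X (disc_boundary X D)) (top_of_set (sphere 0 1)) h"
    by (simp add: subtopology_subtopology inf.absorb2 sphere_cball)
  with hg bd show thesis
    using that by blast
qed

lemma closedin_disc:
  assumes "Hausdorff_space X" "is_disc X D"
  shows "closedin X D"
proof -
  have "compact_space (subtopology X D)"
    using assms(2) homeomorphic_compact_space[of "subtopology X D" "top_of_set (cball (0::complex) 1)"]
    by (simp add: is_disc_def compact_space_subtopology)
  then show ?thesis
    using assms by (auto simp: is_disc_def compactin_subspace intro: compactin_imp_closedin)
qed

lemma connectedin_disc:
  assumes "is_disc X D"
  shows "connectedin X D"
proof -
  have "connected_space (top_of_set (cball (0::complex) 1))"
    by (simp add: connected_space_subtopology convex_connected)
  then show ?thesis
    using assms homeomorphic_connected_space[of "subtopology X D" "top_of_set (cball (0::complex) 1)"]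
    by (simp add: is_disc_def connectedin_def)
qed

lemma connectedin_disc_boundary:
  assumes "is_disc X D"
  shows "connectedin X (disc_boundary X D)" "disc_boundary X D \<noteq> {}"
proof -
  obtain h g where "disc_boundary X D = {x \<in> D. norm (h x) = 1}"
    and h: "homeomorphic_map (subtopology X (disc_boundary X D)) (top_of_set (sphere (0::complex) 1)) h"
    using disc_chart[OF assms] .
  then have sub: "disc_boundary X D \<subseteq> topspace X"
    using assms by (auto simp: is_disc_def)
  have "connected_space (top_of_set (sphere (0::complex) 1))"
    using connected_sphere[of "0::complex" 1] by (simp add: connected_space_subtopology)
  then show "connectedin X (disc_boundary X D)"
    using homeomorphic_connected_space[OF homeomorphic_map_imp_homeomorphic_space[OF h]] sub
    by (simp add: connectedin_def)
  have "h ` disc_boundary X D = sphere 0 1"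
    using homeomorphic_imp_surjective_map[OF h] sub by (simp add: inf.absorb2)
  then have "(1::complex) \<in> h ` disc_boundary X D"
    by simp
  then show "disc_boundary X D \<noteq> {}"
    by (metis empty_iff image_empty)
qed

section \<open>Sectors in the plane and arcs on circles\<close>

text \<open>
  The open cone from the origin over a set of directions. Over an open arc \<open>J\<close> of the unit circle it
  is an open sector, and its part in the closed unit disc is a neighbourhood of \<open>J\<close> in that disc.
\<close>

definition cone_over :: "complex set \<Rightarrow> complex set" where
  "cone_over J = {z. z \<noteq> 0 \<and> sgn z \<in> J}"

lemma open_cone_over:
  assumes "openin (top_of_set (sphere 0 1)) J"
  shows "open (cone_over J)"
proof -
  obtain T where T: "open T" "J = sphere 0 1 \<inter> T"
    using assms by (auto simp: openin_open)
  have "continuous_on (- {0::complex}) sgn"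
    by (intro continuous_intros) auto
  then have "open (- {0} \<inter> sgn -` T)"
    using T(1) by (intro continuous_open_preimage) auto
  moreover have "- {0} \<inter> sgn -` T = cone_over J"
    using T(2) by (auto simp: cone_over_def norm_sgn)
  ultimately show ?thesis
    by simp
qed

lemma cone_over_unit_norm:
  assumes "J \<subseteq> sphere 0 1" 
  shows "{z \<in> cone_over J. norm z = 1} = J"
  using assms by (auto simp: cone_over_def sgn_div_norm)

lemma continuous_on_cone_over:
  assumes "continuous_on J \<phi>"
  shows "continuous_on (cone_over J) (\<lambda>z. \<phi> (sgn z))"
  by (rule continuous_on_compose2[OF assms])
     (auto simp: cone_over_def intro!: continuous_intros)

text \<open>
  Invariance of domain for the circle follows from the planar case: extending \<open>\<phi>\<close> radially
  gives an injective continuous map on the open sector over \<open>J\<close>, and the image of \<open>J\<close> is the part of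
  the image of the sector that lies on the circle.
\<close>

lemma circle_invariance_of_domain:
  fixes \<phi> :: "complex \<Rightarrow> complex"
  assumes J: "openin (top_of_set (sphere 0 1)) J"
    and \<phi>: "continuous_on J \<phi>" "inj_on \<phi> J" "\<phi> ` J \<subseteq> sphere 0 1"
  shows "openin (top_of_set (sphere 0 1)) (\<phi> ` J)"
proof -
  define \<Psi> where "\<Psi> z = norm z *\<^sub>R \<phi> (sgn z)" for z
  have norm_\<Psi>: "norm (\<Psi> z) = norm z" and sgn_\<Psi>: "sgn (\<Psi> z) = \<phi> (sgn z)"
    if "z \<in> cone_over J" for z
  proof -
    have "norm (\<phi> (sgn z)) = 1"
      using that \<phi>(3) by (auto simp: cone_over_def)
    then show "norm (\<Psi> z) = norm z" "sgn (\<Psi> z) = \<phi> (sgn z)"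
      using that by (auto simp: \<Psi>_def cone_over_def sgn_div_norm)
  qed
  have "continuous_on (cone_over J) \<Psi>"
    unfolding \<Psi>_def by (intro continuous_intros continuous_on_cone_over \<phi>(1))
  moreover have "inj_on \<Psi> (cone_over J)"
  proof (rule inj_onI)
    fix z w assume zw: "z \<in> cone_over J" "w \<in> cone_over J" "\<Psi> z = \<Psi> w"
    then have "norm z = norm w" "\<phi> (sgn z) = \<phi> (sgn w)"
      using norm_\<Psi> sgn_\<Psi> by metis+
    then have "norm z = norm w" "sgn z = sgn w"
      using zw(1,2) \<phi>(2) by (auto simp: cone_over_def inj_on_eq_iff)
    moreover have "norm u *\<^sub>R sgn u = u" for u :: complex
      by (cases "u = 0") (simp_all add: sgn_div_norm)
    ultimately show "z = w"
      by metis
  qed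
  ultimately have "open (\<Psi> ` cone_over J)"
    using open_cone_over[OF J] by (intro invariance_of_domain)
  moreover have "\<phi> ` J = sphere 0 1 \<inter> \<Psi> ` cone_over J"
  proof -
    have J_sphere: "J \<subseteq> sphere 0 1"
      using openin_imp_subset[OF J] .
    have "\<phi> z = \<Psi> z \<and> z \<in> cone_over J" if "z \<in> J" for z
      using that J_sphere by (auto simp: \<Psi>_def cone_over_def sgn_div_norm)
    moreover have "\<Psi> z \<in> \<phi> ` J" if "z \<in> cone_over J" "norm (\<Psi> z) = 1" for z
      using that norm_\<Psi>[OF that(1)] by (auto simp: \<Psi>_def cone_over_def)
    ultimately show ?thesis
      using \<phi>(3) by auto
  qed
  ultimately show ?thesis
    by (metis openin_open)
qed

text \<open>
  The map reverses the radial coordinate about the value 1 and moves directions by \<open>\<phi>\<close>. It turns a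
  half-neighbourhood of the arc \<open>J\<close> inside the unit disc into a half-neighbourhood of the arc \<open>K\<close>
  outside of it, and it is what places a second disc next to a first one along a common arc.
\<close>

lemma homeomorphism_cone_over_reflection:
  assumes hom: "homeomorphism J K \<phi> \<psi>" and J: "J \<subseteq> sphere 0 1" and K: "K \<subseteq> sphere 0 1"
  shows "homeomorphism (cone_over J \<inter> cball 0 1) {z \<in> cone_over K. 1 \<le> norm z \<and> norm z < 2}
    (\<lambda>z. (2 - norm z) *\<^sub>R \<phi> (sgn z)) (\<lambda>z. (2 - norm z) *\<^sub>R \<psi> (sgn z))"
    (is "homeomorphism ?A ?B ?f ?g")
proof (rule homeomorphismI)
  have im: "\<phi> x \<in> K" "norm (\<phi> x) = 1" if "x \<in> J" for x
    using that hom K by (auto simp: homeomorphism_def)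
  have im': "\<psi> x \<in> J" "norm (\<psi> x) = 1" if "x \<in> K" for x
    using that hom J by (auto simp: homeomorphism_def)
  have sgn_scale: "sgn (r *\<^sub>R x) = x" if "r > 0" "norm x = 1" for r and x :: complex
    using that by (simp add: sgn_div_norm)
  show "continuous_on ?A ?f"
    using hom by (intro continuous_intros continuous_on_subset[OF continuous_on_cone_over])
       (auto simp: homeomorphism_def)
  show "continuous_on ?B ?g"
    using hom by (intro continuous_intros continuous_on_subset[OF continuous_on_cone_over])
       (auto simp: homeomorphism_def)
  have f: "?f z \<in> ?B \<and> norm (?f z) = 2 - norm z \<and> sgn (?f z) = \<phi> (sgn z)" if "z \<in> ?A" for z
  proof -
    have "sgn z \<in> J" "0 < norm z" "norm z \<le> 1"
      using that by (auto simp: cone_over_def)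
    then show ?thesis
      using im[of "sgn z"] sgn_scale[of "2 - norm z" "\<phi> (sgn z)"] by (auto simp: cone_over_def)
  qed
  have g: "?g z \<in> ?A \<and> norm (?g z) = 2 - norm z \<and> sgn (?g z) = \<psi> (sgn z)" if "z \<in> ?B" for z
  proof -
    have "sgn z \<in> K" "1 \<le> norm z" "norm z < 2"
      using that by (auto simp: cone_over_def)
    then show ?thesis
      using im'[of "sgn z"] sgn_scale[of "2 - norm z" "\<psi> (sgn z)"] by (auto simp: cone_over_def)
  qed
  have norm_sgn_eq: "norm z *\<^sub>R sgn z = z" for z :: complex
    by (cases "z = 0") (simp_all add: sgn_div_norm)
  show "?f ` ?A \<subseteq> ?B" "?g ` ?B \<subseteq> ?A"
    using f g by blast+
  show "?g (?f z) = z" if "z \<in> ?A" for z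
  proof -
    have "\<psi> (\<phi> (sgn z)) = sgn z"
      using that hom by (auto simp: homeomorphism_def cone_over_def)
    moreover have "?g (?f z) = (2 - (2 - norm z)) *\<^sub>R \<psi> (\<phi> (sgn z))"
      using f[OF that] by metis
    ultimately show ?thesis
      using norm_sgn_eq[of z] by simp
  qed
  show "?f (?g z) = z" if "z \<in> ?B" for z
  proof -
    have "\<phi> (\<psi> (sgn z)) = sgn z"
      using that hom by (auto simp: homeomorphism_def cone_over_def)
    moreover have "?f (?g z) = (2 - (2 - norm z)) *\<^sub>R \<phi> (\<psi> (sgn z))"
      using g[OF that] by metis
    ultimately show ?thesis
      using norm_sgn_eq[of z] by simp
  qed
qed

section \<open>Gluing two discs along an arc\<close>

lemma homeomorphic_map_paste_closed:
  assumes X: "closedin X A" "closedin X B" "topspace X = A \<union> B"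
    and Y: "closedin Y C" "closedin Y D" "topspace Y = C \<union> D"
    and fA: "homeomorphic_map (subtopology X A) (subtopology Y C) f"
    and fB: "homeomorphic_map (subtopology X B) (subtopology Y D) f"
    and overlap: "C \<inter> D \<subseteq> f ` (A \<inter> B)"
  shows "homeomorphic_map X Y f"
proof (rule bijective_closed_imp_homeomorphic_map)
  have top: "topspace (subtopology X A) = A" "topspace (subtopology X B) = B"
      "topspace (subtopology Y C) = C" "topspace (subtopology Y D) = D"
    using X Y by auto
  have im: "f ` A = C" "f ` B = D"
    using homeomorphic_imp_surjective_map[OF fA] homeomorphic_imp_surjective_map[OF fB] top by auto
  have inj: "inj_on f A" "inj_on f B"
    using homeomorphic_imp_injective_map[OF fA] homeomorphic_imp_injective_map[OF fB] top by auto
  show "f ` topspace X = topspace Y"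
    using X Y im by auto
  have "x = y" if xy: "x \<in> A" "y \<in> B" "f x = f y" for x y
  proof -
    have "f x \<in> C \<inter> D"
      using im xy by (metis IntI imageI)
    then obtain u where "u \<in> A" "u \<in> B" "f x = f u"
      using overlap by auto
    then show ?thesis
      using inj xy by (metis inj_on_eq_iff)
  qed
  then show "inj_on f (topspace X)"
    using inj X(3) unfolding inj_on_def by (metis Un_iff)
  show "closed_map X Y f"
    unfolding closed_map_def
  proof (intro allI impI)
    fix K assume K: "closedin X K"
    have "closedin (subtopology X A) (K \<inter> A)" "closedin (subtopology X B) (K \<inter> B)"
      using K by (auto simp: closedin_subtopology)
    then have "closedin (subtopology Y C) (f ` (K \<inter> A))" "closedin (subtopology Y D) (f ` (K \<inter> B))"
      using homeomorphic_imp_closed_map[OF fA] homeomorphic_imp_closed_map[OF fB]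
      by (auto simp: closed_map_def)
    then have "closedin Y (f ` (K \<inter> A) \<union> f ` (K \<inter> B))"
      using Y by (blast intro: closedin_trans_full)
    moreover have "f ` (K \<inter> A) \<union> f ` (K \<inter> B) = f ` K"
      using closedin_subset[OF K] X(3) by blast
    ultimately show "closedin Y (f ` K)"
      by simp
  qed
  show "continuous_map X Y f"
    unfolding continuous_map_closedin
  proof (intro conjI allI impI)
    show "f \<in> topspace X \<rightarrow> topspace Y"
      using X Y im by auto
    fix K assume K: "closedin Y K"
    have "closedin (subtopology X A) {x \<in> A. f x \<in> K \<inter> C}"
      using closedin_continuous_map_preimage[OF homeomorphic_imp_continuous_map[OF fA], of "K \<inter> C"] K
      unfolding top by (auto simp: closedin_subtopology)
    moreover have "closedin (subtopology X B) {x \<in> B. f x \<in> K \<inter> D}"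
      using closedin_continuous_map_preimage[OF homeomorphic_imp_continuous_map[OF fB], of "K \<inter> D"] K
      unfolding top by (auto simp: closedin_subtopology)
    ultimately have "closedin X ({x \<in> A. f x \<in> K \<inter> C} \<union> {x \<in> B. f x \<in> K \<inter> D})"
      using X by (blast intro: closedin_trans_full)
    moreover have "{x \<in> A. f x \<in> K \<inter> C} \<union> {x \<in> B. f x \<in> K \<inter> D} = {x \<in> topspace X. f x \<in> K}"
      using X im by auto
    ultimately show "closedin X {x \<in> topspace X. f x \<in> K}"
      by simp
  qed
qed

text \<open>
  On \<open>I\<close> the charts of the discs differ by an injective continuous map between parts of the unit circle,
  and invariance of domain applies to it. Thus two boundary circles that share an arc can only
  separate at its ends.
\<close>

lemma disc_boundary_transfer_openin:
  assumes D: "is_disc X D" and E: "is_disc X E"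
    and I: "I \<subseteq> disc_boundary X D" "I \<subseteq> disc_boundary X E"
    and op: "openin (subtopology X (disc_boundary X D)) I"
  shows "openin (subtopology X (disc_boundary X E)) I"
proof -
  have top: "topspace (subtopology X D) = D" "topspace (subtopology X E) = E"
    using D E by (auto simp: is_disc_def)
  obtain h g where hg: "homeomorphic_maps (subtopology X D) (top_of_set (cball (0::complex) 1)) h g"
    and bD: "disc_boundary X D = {x \<in> D. norm (h x) = 1}"
    and hD: "homeomorphic_map (subtopology X (disc_boundary X D)) (top_of_set (sphere 0 1)) h"
    using disc_chart[OF D] .
  obtain k l where kl: "homeomorphic_maps (subtopology X E) (top_of_set (cball (0::complex) 1)) k l"
    and bE: "disc_boundary X E = {x \<in> E. norm (k x) = 1}"
    and kE: "homeomorphic_map (subtopology X (disc_boundary X E)) (top_of_set (sphere 0 1)) k"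
    using disc_chart[OF E] .
  have h: "homeomorphic_map (subtopology X D) (top_of_set (cball (0::complex) 1)) h"
    and k: "homeomorphic_map (subtopology X E) (top_of_set (cball (0::complex) 1)) k"
    using hg kl homeomorphic_maps_map by blast+
  have gh: "g (h x) = x" if "x \<in> D" for x
    using hg that top by (simp add: homeomorphic_maps_def)
  have subD: "I \<subseteq> D" and subE: "I \<subseteq> E"
    using I bD bE by auto
  have kI: "k ` I \<subseteq> sphere 0 1"
    using I(2) bE by auto
  have J: "openin (top_of_set (sphere 0 1)) (h ` I)"
    using homeomorphic_imp_open_map[OF hD] op by (simp add: open_map_def)
  have hI: "h ` I \<subseteq> cball 0 1"
    using openin_imp_subset[OF J] by auto
  have "continuous_map (top_of_set (h ` I)) (subtopology X D) g"
    using hg hI by (auto simp: homeomorphic_maps_def intro: continuous_map_from_subtopology_mono)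
  moreover have "g ` h ` I \<subseteq> I"
    using gh subD by auto
  ultimately have "continuous_map (top_of_set (h ` I)) (subtopology X E) g"
    using subE by (auto simp: continuous_map_in_subtopology)
  moreover have "continuous_map (subtopology X E) euclidean k"
    using homeomorphic_imp_continuous_map[OF k] by (simp add: continuous_map_in_subtopology)
  ultimately have "continuous_on (h ` I) (k \<circ> g)"
    using continuous_map_compose continuous_map_iff_continuous by blast
  moreover have "inj_on (k \<circ> g) (h ` I)"
  proof (rule inj_onI)
    fix u v assume "u \<in> h ` I" "v \<in> h ` I" "(k \<circ> g) u = (k \<circ> g) v"
    moreover from this obtain x y where "u = h x" "v = h y" "x \<in> I" "y \<in> I"
      by blast
    ultimately have xy: "u = h x" "v = h y" "x \<in> I" "y \<in> I" "k x = k y"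
      using gh[OF subsetD[OF subD \<open>x \<in> I\<close>]] gh[OF subsetD[OF subD \<open>y \<in> I\<close>]] by auto
    then have "x = y"
      using homeomorphic_imp_injective_map[OF k] subE unfolding top by (meson inj_onD subsetD)
    then show "u = v"
      using xy by simp
  qed
  moreover have img: "(k \<circ> g) ` h ` I = k ` I"
    using gh subD by (force simp: image_image)
  ultimately have "openin (top_of_set (sphere 0 1)) (k ` I)"
    using circle_invariance_of_domain[OF J, of "k \<circ> g"] kI by metis
  then show ?thesis
    using homeomorphic_map_openness_eq[OF kE, of I] I(2) surface_boundary_subset[of "subtopology X E"]
    by auto
qed

text \<open>
  Near a set \<open>I\<close> that is open in both boundary circles, two glued discs fit together to a piece of the
  plane. The chart of \<open>D\<close> maps a neighbourhood of \<open>I\<close> in \<open>D\<close> to the part of a sector inside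
  the unit circle. The chart of \<open>E\<close>, corrected by the transition map on \<open>I\<close> and reflected in the
  circle, maps a neighbourhood of \<open>I\<close> in \<open>E\<close> to the part outside. On \<open>I\<close> both maps agree.
\<close>

lemma glued_discs_interior:
  assumes X: "Hausdorff_space X" "topspace X = D \<union> E"
    and D: "is_disc X D" and E: "is_disc X E"
    and DE: "D \<inter> E \<subseteq> disc_boundary X D \<inter> disc_boundary X E"
    and I: "I \<subseteq> disc_boundary X D \<inter> disc_boundary X E"
    and ID: "openin (subtopology X (disc_boundary X D)) I"
    and IE: "openin (subtopology X (disc_boundary X E)) I"
    and x: "x \<in> I"
  shows "x \<notin> surface_boundary X"
proof -
  have top: "topspace (subtopology X D) = D" "topspace (subtopology X E) = E"
    using X by auto
  obtain h g where hg: "homeomorphic_maps (subtopology X D) (top_of_set (cball (0::complex) 1)) h g"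
    and bD: "disc_boundary X D = {x \<in> D. norm (h x) = 1}"
    and hD: "homeomorphic_map (subtopology X (disc_boundary X D)) (top_of_set (sphere 0 1)) h"
    using disc_chart[OF D] .
  obtain k l where kl: "homeomorphic_maps (subtopology X E) (top_of_set (cball (0::complex) 1)) k l"
    and bE: "disc_boundary X E = {x \<in> E. norm (k x) = 1}"
    and kE: "homeomorphic_map (subtopology X (disc_boundary X E)) (top_of_set (sphere 0 1)) k"
    using disc_chart[OF E] .
  have h: "homeomorphic_map (subtopology X D) (top_of_set (cball 0 1)) h"
    and k: "homeomorphic_map (subtopology X E) (top_of_set (cball 0 1)) k"
    using hg kl homeomorphic_maps_map by blast+
  have hD_im: "h ` D = cball 0 1" and kE_im: "k ` E = cball 0 1"
    using homeomorphic_imp_surjective_map[OF h] homeomorphic_imp_surjective_map[OF k] top by auto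
  have inj: "inj_on h D" "inj_on k E"
    using homeomorphic_imp_injective_map[OF h] homeomorphic_imp_injective_map[OF k] top by auto
  have gh: "g (h y) = y" if "y \<in> D" for y
    using hg that top by (simp add: homeomorphic_maps_def)
  have lk: "l (k y) = y" if "y \<in> E" for y
    using kl that top by (simp add: homeomorphic_maps_def)
  have IDE: "I \<subseteq> D" "I \<subseteq> E" and normI: "\<And>y. y \<in> I \<Longrightarrow> norm (h y) = 1 \<and> norm (k y) = 1"
    using I bD bE by auto
  define J K where "J = h ` I" and "K = k ` I"
  have J: "openin (top_of_set (sphere 0 1)) J" and K: "openin (top_of_set (sphere 0 1)) K"
    unfolding J_def K_def
    using homeomorphic_imp_open_map[OF hD] homeomorphic_imp_open_map[OF kE] ID IE
    by (simp_all add: open_map_def)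
  have Js: "J \<subseteq> sphere 0 1" and Ks: "K \<subseteq> sphere 0 1"
    using J K openin_imp_subset by blast+
  then have Jc: "J \<subseteq> cball 0 1" and Kc: "K \<subseteq> cball 0 1"
    using sphere_cball by blast+
  define U where "U = {y \<in> D. h y \<in> cone_over J}"
  define V where "V = {y \<in> E. k y \<in> cone_over K}"
  have IU: "I = {y \<in> U. norm (h y) = 1}"
  proof -
    have "y \<in> I" if "y \<in> D" "h y \<in> J" for y
      using that inj(1) IDE unfolding J_def by (meson inj_on_image_mem_iff)
    then show ?thesis
      using equalityD1[OF cone_over_unit_norm[OF Js]] equalityD2[OF cone_over_unit_norm[OF Js]] normI IDE(1)
      unfolding U_def J_def by fast
  qed
  have IV: "I = {y \<in> V. norm (k y) = 1}"
  proof -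
    have "y \<in> I" if "y \<in> E" "k y \<in> K" for y
      using that inj(2) IDE unfolding K_def by (meson inj_on_image_mem_iff)
    then show ?thesis
      using equalityD1[OF cone_over_unit_norm[OF Ks]] equalityD2[OF cone_over_unit_norm[OF Ks]] normI IDE(2)
      unfolding V_def K_def by fast
  qed
  have IUV: "I \<subseteq> U \<inter> V"
    using equalityD1[OF IU] equalityD1[OF IV] by blast
  have norm1: "norm (h y) = 1" "norm (k y) = 1" if "y \<in> D" "y \<in> E" for y
    using DE that unfolding bD bE by blast+
  have EU: "E \<inter> U \<subseteq> I" and DV: "D \<inter> V \<subseteq> I"
    using norm1 equalityD2[OF IU] equalityD2[OF IV] by (auto simp: U_def V_def)
  have UD: "U \<subseteq> D" and VE: "V \<subseteq> E"
    by (auto simp: U_def V_def)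
  have closed: "closedin X D" "closedin X E"
    using X D E by (auto intro: closedin_disc)
  have openUV: "openin X (U \<union> V)"
  proof -
    have "continuous_map (subtopology X D) euclidean h" "continuous_map (subtopology X E) euclidean k"
      using homeomorphic_imp_continuous_map[OF h] homeomorphic_imp_continuous_map[OF k]
      by (simp_all add: continuous_map_in_subtopology)
    then have "openin (subtopology X D) U" "openin (subtopology X E) V"
      using openin_continuous_map_preimage[of "subtopology X D" euclidean h "cone_over J"]
        openin_continuous_map_preimage[of "subtopology X E" euclidean k "cone_over K"]
        open_cone_over[OF J] open_cone_over[OF K] unfolding top U_def V_def by auto
    then have "closedin (subtopology X D) (D - U)" "closedin (subtopology X E) (E - V)"
      using top by (metis closedin_def Diff_subset double_diff openin_subset order_refl)+
    then have "closedin X ((D - U) \<union> (E - V))"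
      using closed by (blast intro: closedin_trans_full)
    moreover have "topspace X - (U \<union> V) = (D - U) \<union> (E - V)"
      using X(2) EU DV IUV UD VE by blast
    ultimately show ?thesis
      using X(2) UD VE by (auto simp: openin_closedin_eq)
  qed
  \<comment> \<open>The radius 2 is the mirror image of the centre of \<open>E\<close>, which has radius 0 in its chart.\<close>
  define T where "T = {z \<in> cone_over J. norm z < 2}"
  have openT: "open T"
  proof -
    have "T = cone_over J \<inter> ball 0 2"
      by (auto simp: T_def)
    then show ?thesis
      using open_cone_over[OF J] by auto
  qed
  define C where "C = cone_over J \<inter> cball 0 1"
  define R where "R = {z \<in> cone_over J. 1 \<le> norm z \<and> norm z < 2}"
  have fU: "homeomorphic_map (subtopology X U) (top_of_set C) h"
  proof -
    have "homeomorphic_map (subtopology (subtopology X D) U) (subtopology (top_of_set (cball 0 1)) C) h"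
      using top by (intro homeomorphic_map_subtopologies_alt[OF h]) (auto simp: U_def C_def)
    then show ?thesis
      using UD by (simp add: subtopology_subtopology inf.absorb2 C_def)
  qed
  define \<phi> where "\<phi> = h \<circ> l"
  define \<psi> where "\<psi> = k \<circ> g"
  have hom: "homeomorphism K J \<phi> \<psi>"
  proof -
    have "continuous_on K \<phi>"
    proof -
      have "continuous_map (top_of_set K) (subtopology X E) l"
        using kl continuous_map_from_subtopology_mono[OF _ Kc] unfolding homeomorphic_maps_def by blast
      moreover have "l ` K \<subseteq> D"
        using lk IDE by (force simp: K_def)
      ultimately have "continuous_map (top_of_set K) (subtopology X D) l"
        by (auto simp: continuous_map_in_subtopology)
      moreover have "continuous_map (subtopology X D) euclidean h"
        using homeomorphic_imp_continuous_map[OF h] by (simp add: continuous_map_in_subtopology)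
      ultimately show ?thesis
        unfolding \<phi>_def using continuous_map_compose continuous_map_iff_continuous by blast
    qed
    moreover have "continuous_on J \<psi>"
    proof -
      have "continuous_map (top_of_set J) (subtopology X D) g"
        using hg continuous_map_from_subtopology_mono[OF _ Jc] unfolding homeomorphic_maps_def by blast
      moreover have "g ` J \<subseteq> E"
        using gh IDE by (force simp: J_def)
      ultimately have "continuous_map (top_of_set J) (subtopology X E) g"
        by (auto simp: continuous_map_in_subtopology)
      moreover have "continuous_map (subtopology X E) euclidean k"
        using homeomorphic_imp_continuous_map[OF k] by (simp add: continuous_map_in_subtopology)
      ultimately show ?thesis
        unfolding \<psi>_def using continuous_map_compose continuous_map_iff_continuous by blast
    qed
    moreover have "\<phi> (k y) = h y \<and> \<psi> (h y) = k y" if "y \<in> I" for y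
      using that IDE gh lk by (auto simp: \<phi>_def \<psi>_def)
    ultimately show ?thesis
      by (intro homeomorphismI) (auto simp: J_def K_def)
  qed
  \<comment> \<open>The chart of \<open>E\<close> near \<open>I\<close>, moved to the outside of the unit circle.\<close>
  define q where "q y = (2 - norm (k y)) *\<^sub>R \<phi> (sgn (k y))" for y
  have fV: "homeomorphic_map (subtopology X V) (top_of_set R) q"
  proof -
    have "homeomorphic_map (subtopology (subtopology X E) V)
        (subtopology (top_of_set (cball 0 1)) (cone_over K \<inter> cball 0 1)) k"
      using top by (intro homeomorphic_map_subtopologies_alt[OF k]) (auto simp: V_def)
    then have "homeomorphic_map (subtopology X V) (top_of_set (cone_over K \<inter> cball 0 1)) k"
      using VE by (simp add: subtopology_subtopology inf.absorb2)
    moreover have "homeomorphic_map (top_of_set (cone_over K \<inter> cball 0 1)) (top_of_set R)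
        (\<lambda>z. (2 - norm z) *\<^sub>R \<phi> (sgn z))"
      using homeomorphism_imp_homeomorphic_maps[OF homeomorphism_cone_over_reflection[OF hom Ks Js, folded R_def]]
      by (simp only: homeomorphic_maps_map)
    ultimately have "homeomorphic_map (subtopology X V) (top_of_set R)
        ((\<lambda>z. (2 - norm z) *\<^sub>R \<phi> (sgn z)) \<circ> k)"
      by (rule homeomorphic_map_compose)
    then show ?thesis
      by (simp add: q_def[abs_def] o_def)
  qed
  define p where "p y = (if y \<in> D then h y else q y)" for y
  have pU: "p y = h y" if "y \<in> U" for y
    using that UD by (auto simp: p_def)
  have pV: "p y = q y" if "y \<in> V" for y
  proof (cases "y \<in> D")
    case True
    then have "y \<in> I"
      using DV that by blast
    then show ?thesis
      using True IDE lk normI by (auto simp: p_def q_def \<phi>_def sgn_div_norm)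
  qed (simp add: p_def)
  have "homeomorphic_map (subtopology X (U \<union> V)) (top_of_set T) p"
  proof (rule homeomorphic_map_paste_closed[where A = U and B = V and C = C and D = R])
    have "D \<inter> (U \<union> V) = U" "E \<inter> (U \<union> V) = V"
      using UD VE EU DV IUV by blast+
    then show "closedin (subtopology X (U \<union> V)) U" "closedin (subtopology X (U \<union> V)) V"
      using closed by (metis closedin_subtopology)+
    show "topspace (subtopology X (U \<union> V)) = U \<union> V"
      using openin_subset[OF openUV] by auto
    have "C = T \<inter> cball 0 1" "R = T \<inter> {z. 1 \<le> norm z}"
      by (auto simp: C_def R_def T_def)
    moreover have "closed {z::complex. 1 \<le> norm z}"
      by (intro closed_Collect_le continuous_intros)
    ultimately show "closedin (top_of_set T) C" "closedin (top_of_set T) R"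
      by (auto simp: closedin_closed)
    show "topspace (top_of_set T) = C \<union> R"
      by (auto simp: C_def R_def T_def)
    have "subtopology (top_of_set T) C = top_of_set C" "subtopology (top_of_set T) R = top_of_set R"
      by (auto simp: subtopology_subtopology C_def R_def T_def intro!: arg_cong[where f = top_of_set])
    moreover have "subtopology (subtopology X (U \<union> V)) U = subtopology X U"
      "subtopology (subtopology X (U \<union> V)) V = subtopology X V"
      by (auto simp: subtopology_subtopology inf.absorb2)
    ultimately show "homeomorphic_map (subtopology (subtopology X (U \<union> V)) U) (subtopology (top_of_set T) C) p"
      "homeomorphic_map (subtopology (subtopology X (U \<union> V)) V) (subtopology (top_of_set T) R) p"
      using homeomorphic_map_eq[OF fU, of p] homeomorphic_map_eq[OF fV, of p] pU pV by auto
    have "C \<inter> R = {z \<in> cone_over J. norm z = 1}"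
      by (auto simp: C_def R_def)
    also have "\<dots> = J"
      by (rule cone_over_unit_norm[OF Js])
    also have "J = p ` I"
      unfolding J_def by (rule image_cong) (use pU IUV in auto)
    finally show "C \<inter> R \<subseteq> p ` (U \<inter> V)"
      using IUV by blast
  qed
  then have "planar_at X x"
    using openUV openT x IUV by (intro planar_atI[of _ "U \<union> V" _ T]) auto
  then show ?thesis
    by (simp add: surface_boundary_eq)
qed

section \<open>The boundary of a surface glued from discs\<close>

definition disc_family :: "'a topology \<Rightarrow> 'a set set \<Rightarrow> bool" where
  "disc_family X \<D> \<longleftrightarrow> finite \<D> \<and> pairwise disjnt \<D> \<and> (\<forall>D \<in> \<D>. is_disc X D)"

text \<open>
  The union of the boundary circles of the discs. For the vertices or the bands of a ribbon graph this
  differs in general from the boundary of the surface, as it contains the segments of attachment.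
\<close>

definition boundary_curves :: "'a topology \<Rightarrow> 'a set set \<Rightarrow> 'a set" where
  "boundary_curves X \<D> = (\<Union>D \<in> \<D>. disc_boundary X D)"

definition meet_in_boundaries :: "'a topology \<Rightarrow> 'a set set \<Rightarrow> 'a set set \<Rightarrow> bool" where
  "meet_in_boundaries X \<D> \<E> \<longleftrightarrow>
     (\<forall>D \<in> \<D>. \<forall>E \<in> \<E>. D \<inter> E \<subseteq> disc_boundary X D \<inter> disc_boundary X E)"

lemma disc_family_subset: "disc_family X \<D> \<Longrightarrow> \<E> \<subseteq> \<D> \<Longrightarrow> disc_family X \<E>"
  unfolding disc_family_def by (meson finite_subset pairwise_subset subsetD)

lemma disc_family_eq: "disc_family X \<D> \<Longrightarrow> D \<in> \<D> \<Longrightarrow> E \<in> \<D> \<Longrightarrow> x \<in> D \<Longrightarrow> x \<in> E \<Longrightarrow> D = E"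
  unfolding disc_family_def pairwise_def disjnt_iff by blast

lemma disc_boundary_subset: "disc_boundary X D \<subseteq> D"
  using surface_boundary_subset[of "subtopology X D"] by auto

lemma boundary_curves_subset: "boundary_curves X \<D> \<subseteq> \<Union>\<D>"
  using disc_boundary_subset unfolding boundary_curves_def by fastforce

lemma closedin_Union_discs:
  assumes "Hausdorff_space X" "disc_family X \<D>"
  shows "closedin X (\<Union>\<D>)"
  using assms closedin_disc unfolding disc_family_def by (intro closedin_Union) auto

lemma closedin_boundary_curves:
  assumes "Hausdorff_space X" "disc_family X \<D>"
  shows "closedin X (boundary_curves X \<D>)"
proof -
  have "closedin X (disc_boundary X D)" if "D \<in> \<D>" for D
    using that assms closedin_disc closedin_surface_boundary closedin_trans_full
    unfolding disc_family_def by metis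
  then show ?thesis
    unfolding boundary_curves_def using assms(2)
    by (intro closedin_Union) (auto simp: disc_family_def)
qed

text \<open>
  Distinct discs of a family have disjoint boundary circles, so symmetric differences of edge sets
  turn into symmetric differences of point sets.
\<close>

lemma boundary_curves_sym_diff:
  assumes D: "disc_family X \<D>" and sub: "\<A> \<subseteq> \<D>" "\<B> \<subseteq> \<D>"
  shows "boundary_curves X (sym_diff \<A> \<B>) = sym_diff (boundary_curves X \<A>) (boundary_curves X \<B>)"
proof -
  have same: "D = E" if "D \<in> \<D>" "E \<in> \<D>" "x \<in> disc_boundary X D" "x \<in> disc_boundary X E" for D E x
    using disc_family_eq[OF D that(1,2)] subsetD[OF disc_boundary_subset that(3)]
      subsetD[OF disc_boundary_subset that(4)] by blast
  have iff: "x \<in> boundary_curves X \<C> \<longleftrightarrow> D \<in> \<C>"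
    if D: "D \<in> \<D>" "x \<in> disc_boundary X D" and \<C>: "\<C> \<subseteq> \<D>" for x D \<C>
  proof
    assume "x \<in> boundary_curves X \<C>"
    then obtain C where C: "C \<in> \<C>" "x \<in> disc_boundary X C"
      by (auto simp: boundary_curves_def)
    then have "D = C"
      using same[OF D(1) subsetD[OF \<C> C(1)] D(2) C(2)] by simp
    then show "D \<in> \<C>"
      using C(1) by simp
  next
    assume "D \<in> \<C>"
    then show "x \<in> boundary_curves X \<C>"
      using D(2) by (auto simp: boundary_curves_def)
  qed
  show ?thesis
  proof (intro equalityI subsetI)
    fix x assume "x \<in> boundary_curves X (sym_diff \<A> \<B>)"
    then obtain D where D: "D \<in> sym_diff \<A> \<B>" "x \<in> disc_boundary X D"
      by (auto simp: boundary_curves_def)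
    then have "D \<in> \<D>"
      using sub by blast
    then show "x \<in> sym_diff (boundary_curves X \<A>) (boundary_curves X \<B>)"
      using D iff sub by simp
  next
    fix x assume x: "x \<in> sym_diff (boundary_curves X \<A>) (boundary_curves X \<B>)"
    then obtain D where D: "D \<in> \<A> \<union> \<B>" "x \<in> disc_boundary X D"
      by (auto simp: boundary_curves_def)
    then have DD: "D \<in> \<D>"
      using sub by blast
    then have "D \<in> sym_diff \<A> \<B>"
      using x iff[OF DD D(2) sub(1)] iff[OF DD D(2) sub(2)] by simp
    then show "x \<in> boundary_curves X (sym_diff \<A> \<B>)"
      using D(2) by (auto simp: boundary_curves_def)
  qed
qed

lemma boundary_curves_away_from:
  assumes "y \<notin> \<Union>(\<D> - {D})"
  shows "y \<in> boundary_curves X \<D> \<longleftrightarrow> D \<in> \<D> \<and> y \<in> disc_boundary X D"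
proof -
  have "C = D" if "C \<in> \<D>" "y \<in> disc_boundary X C" for C
    using subsetD[OF disc_boundary_subset that(2)] that(1) assms by blast
  then show ?thesis
    unfolding boundary_curves_def by blast
qed

lemma surface_boundary_away_from:
  assumes R: "closedin X R" and top: "topspace X \<subseteq> D \<union> R" and x: "x \<in> topspace X" "x \<notin> R"
  shows "x \<in> surface_boundary X \<longleftrightarrow> x \<in> surface_boundary (subtopology X D)"
  using assms by (intro surface_boundary_local[of X "topspace X - R"]) auto

lemma surface_boundary_only_disc:
  assumes X: "Hausdorff_space X" "topspace X = \<Union>\<D> \<union> \<Union>\<E>"
    and \<D>: "disc_family X \<D>" and \<E>: "disc_family X \<E>"
    and x: "D \<in> \<D>" "x \<in> D" "x \<notin> \<Union>\<E>"
  shows "x \<in> surface_boundary X \<longleftrightarrow> x \<in> disc_boundary X D"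
proof (rule surface_boundary_away_from)
  show "closedin X (\<Union>(\<D> - {D}) \<union> \<Union>\<E>)"
    using X(1) \<D> \<E> by (intro closedin_Un closedin_Union_discs) (auto intro: disc_family_subset)
  show "topspace X \<subseteq> D \<union> (\<Union>(\<D> - {D}) \<union> \<Union>\<E>)"
    using X(2) by blast
  show "x \<in> topspace X"
    using X(2) x by blast
  show "x \<notin> \<Union>(\<D> - {D}) \<union> \<Union>\<E>"
    using x disc_family_eq[OF \<D>] by blast
qed

text \<open>
  The formula for the boundary of a surface glued from two families of discs. A point that lies in one
  disc only is a boundary point exactly if it is on the circle of this disc. If the point lies in two
  discs, either it is a limit of such boundary points, and then it is a boundary point because the
  boundary is closed, or near the point the two circles coincide, and then it is an interior point by
  gluing. In this form the endpoints of the segments of attachment, where the boundary has corners,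
  need no local model of their own.
\<close>

lemma surface_boundary_discs_whole:
  assumes X: "Hausdorff_space X" "topspace X = \<Union>\<D> \<union> \<Union>\<E>"
    and \<D>: "disc_family X \<D>" and \<E>: "disc_family X \<E>" and meet: "meet_in_boundaries X \<D> \<E>"
  shows "surface_boundary X = X closure_of (sym_diff (boundary_curves X \<D>) (boundary_curves X \<E>))"
    (is "_ = X closure_of ?Q")
proof
  note only\<D> = surface_boundary_only_disc[OF X \<D> \<E>]
  have only\<E>: "x \<in> surface_boundary X \<longleftrightarrow> x \<in> disc_boundary X E"
    if "E \<in> \<E>" "x \<in> E" "x \<notin> \<Union>\<D>" for x E
    using surface_boundary_only_disc[of X \<E> \<D>] X \<D> \<E> that by (simp add: Un_commute)
  have meetD: "x \<in> disc_boundary X D \<and> x \<in> disc_boundary X E"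
    if "D \<in> \<D>" "E \<in> \<E>" "x \<in> D" "x \<in> E" for x D E
    using meet that unfolding meet_in_boundaries_def by blast
  have "?Q \<subseteq> surface_boundary X"
  proof
    fix x assume "x \<in> ?Q"
    then consider (\<D>) D where "D \<in> \<D>" "x \<in> disc_boundary X D" "x \<notin> boundary_curves X \<E>"
      | (\<E>) E where "E \<in> \<E>" "x \<in> disc_boundary X E" "x \<notin> boundary_curves X \<D>"
      by (auto simp: boundary_curves_def)
    then show "x \<in> surface_boundary X"
    proof cases
      case \<D>
      moreover have "x \<in> D"
        using \<D> disc_boundary_subset by fast
      moreover from this have "x \<notin> \<Union>\<E>"
        using \<D> meetD unfolding boundary_curves_def by blast
      ultimately show ?thesis
        using only\<D> by blast
    next
      case \<E>
      moreover have "x \<in> E"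
        using \<E> disc_boundary_subset by fast
      moreover from this have "x \<notin> \<Union>\<D>"
        using \<E> meetD unfolding boundary_curves_def by blast
      ultimately show ?thesis
        using only\<E> by blast
    qed
  qed
  then show "X closure_of ?Q \<subseteq> surface_boundary X"
    using closedin_surface_boundary by (rule closure_of_minimal)
  show "surface_boundary X \<subseteq> X closure_of ?Q"
  proof (rule subsetI, rule ccontr)
    fix x assume x: "x \<in> surface_boundary X" and "x \<notin> X closure_of ?Q"
    moreover have xX: "x \<in> topspace X"
      using x surface_boundary_subset by fast
    ultimately obtain W where W: "openin X W" "x \<in> W" and WQ: "\<And>y. y \<in> W \<Longrightarrow> y \<notin> ?Q"
      unfolding in_closure_of by blast
    consider (\<D>) D where "D \<in> \<D>" "x \<in> D" "x \<notin> \<Union>\<E>" | (\<E>) E where "E \<in> \<E>" "x \<in> E" "x \<notin> \<Union>\<D>"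
      | (both) D E where "D \<in> \<D>" "E \<in> \<E>" "x \<in> D" "x \<in> E"
      using xX X(2) by blast
    then show False
    proof cases
      case \<D>
      then have "x \<in> disc_boundary X D"
        using x only\<D> by blast
      then have "x \<in> boundary_curves X \<D>"
        using \<D>(1) by (auto simp: boundary_curves_def)
      moreover have "x \<notin> boundary_curves X \<E>"
        using \<D>(3) boundary_curves_subset by fast
      ultimately show False
        using WQ[OF W(2)] by blast
    next
      case \<E>
      then have "x \<in> disc_boundary X E"
        using x only\<E> by blast
      then have "x \<in> boundary_curves X \<E>"
        using \<E>(1) by (auto simp: boundary_curves_def)
      moreover have "x \<notin> boundary_curves X \<D>"
        using \<E>(3) boundary_curves_subset by fast
      ultimately show False
        using WQ[OF W(2)] by blast
    next
      case both
      \<comment> \<open>Removing the closed union \<open>R\<close> of the remaining discs reduces the situation to \<open>D\<close> and \<open>E\<close>.\<close>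
      define R where "R = \<Union>(\<D> - {D}) \<union> \<Union>(\<E> - {E})"
      have R: "closedin X R"
        unfolding R_def using X(1) \<D> \<E>
        by (intro closedin_Un closedin_Union_discs) (auto intro: disc_family_subset)
      have xR: "x \<notin> R"
        using both disc_family_eq[OF \<D>] disc_family_eq[OF \<E>] unfolding R_def by blast
      define Y where "Y = subtopology X (D \<union> E)"
      have subtop: "subtopology Y T = subtopology X T" if "T \<subseteq> D \<union> E" for T
        using that by (simp add: Y_def subtopology_subtopology inf.absorb2)
      have Y_D: "subtopology Y D = subtopology X D" and Y_E: "subtopology Y E = subtopology X E"
        by (auto intro: subtop)
      have bsub: "disc_boundary X D \<subseteq> D \<union> E" "disc_boundary X E \<subseteq> D \<union> E"
        using disc_boundary_subset by fast+
      have disc: "is_disc X D" "is_disc X E"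
        using both \<D> \<E> by (auto simp: disc_family_def)
      define I where "I = disc_boundary X D \<inter> disc_boundary X E \<inter> (W - R)"
      have ID: "I = (W - R) \<inter> disc_boundary X D" and IE: "I = (W - R) \<inter> disc_boundary X E"
      proof -
        have "y \<in> disc_boundary X E" if y: "y \<in> W" "y \<notin> R" "y \<in> disc_boundary X D" for y
        proof -
          have "y \<in> boundary_curves X \<D>"
            using y(3) both(1) by (auto simp: boundary_curves_def)
          then have "y \<in> boundary_curves X \<E>"
            using WQ[OF y(1)] by blast
          then obtain E' where "E' \<in> \<E>" "y \<in> disc_boundary X E'"
            by (auto simp: boundary_curves_def)
          moreover from this have "y \<in> E'"
            using disc_boundary_subset by fast
          ultimately show ?thesis
            using y(2) unfolding R_def by blast
        qed
        moreover have "y \<in> disc_boundary X D" if y: "y \<in> W" "y \<notin> R" "y \<in> disc_boundary X E" for y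
        proof -
          have "y \<in> boundary_curves X \<E>"
            using y(3) both(2) by (auto simp: boundary_curves_def)
          then have "y \<in> boundary_curves X \<D>"
            using WQ[OF y(1)] by blast
          then obtain D' where "D' \<in> \<D>" "y \<in> disc_boundary X D'"
            by (auto simp: boundary_curves_def)
          moreover from this have "y \<in> D'"
            using disc_boundary_subset by fast
          ultimately show ?thesis
            using y(2) unfolding R_def by blast
        qed
        ultimately show "I = (W - R) \<inter> disc_boundary X D" "I = (W - R) \<inter> disc_boundary X E"
          unfolding I_def by blast+
      qed
      have op: "openin X (W - R)"
        using W(1) R by blast
      have "x \<notin> surface_boundary Y"
      proof (rule glued_discs_interior[where D = D and E = E and I = I])
        show "Hausdorff_space Y"
          using X(1) by (simp add: Y_def Hausdorff_space_subtopology)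
        show "topspace Y = D \<union> E"
          using disc by (auto simp: Y_def is_disc_def)
        then show "is_disc Y D" "is_disc Y E"
          using disc by (auto simp: is_disc_def Y_D Y_E)
        show "D \<inter> E \<subseteq> disc_boundary Y D \<inter> disc_boundary Y E"
          using meetD both by (auto simp: Y_D Y_E)
        show "I \<subseteq> disc_boundary Y D \<inter> disc_boundary Y E"
          by (auto simp: Y_D Y_E I_def)
        show "openin (subtopology Y (disc_boundary Y D)) I"
          unfolding Y_D subtop[OF bsub(1)] openin_subtopology using op ID by blast
        show "openin (subtopology Y (disc_boundary Y E)) I"
          unfolding Y_E subtop[OF bsub(2)] openin_subtopology using op IE by blast
        show "x \<in> I"
          using W(2) xR meetD both by (auto simp: I_def)
      qed
      moreover have "x \<in> surface_boundary X \<longleftrightarrow> x \<in> surface_boundary Y"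
        unfolding Y_def using R xX xR X(2)
        by (intro surface_boundary_away_from[of X R]) (auto simp: R_def)
      ultimately show False
        using x by blast
    qed
  qed
qed

lemma surface_boundary_discs:
  assumes X: "Hausdorff_space X"
    and \<D>: "disc_family X \<D>" and \<E>: "disc_family X \<E>" and meet: "meet_in_boundaries X \<D> \<E>"
  shows "surface_boundary (subtopology X (\<Union>\<D> \<union> \<Union>\<E>)) =
    X closure_of (sym_diff (boundary_curves X \<D>) (boundary_curves X \<E>))"
proof -
  let ?U = "\<Union>\<D> \<union> \<Union>\<E>"
  let ?Y = "subtopology X ?U"
  have sub: "subtopology ?Y D = subtopology X D" if "D \<in> \<D> \<union> \<E>" for D
  proof -
    have "D \<subseteq> ?U"
      using that by blast
    then show ?thesis
      by (simp add: subtopology_subtopology inf.absorb2)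
  qed
  have U: "?U \<subseteq> topspace X"
    using \<D> \<E> by (auto simp: disc_family_def is_disc_def)
  have closed: "closedin X ?U"
    using X \<D> \<E> by (intro closedin_Un closedin_Union_discs)
  have "surface_boundary ?Y =
      ?Y closure_of (sym_diff (boundary_curves ?Y \<D>) (boundary_curves ?Y \<E>))"
  proof (rule surface_boundary_discs_whole)
    show "Hausdorff_space ?Y"
      using X by (simp add: Hausdorff_space_subtopology)
    show "topspace ?Y = ?U"
      using U by auto
    show "disc_family ?Y \<D>" "disc_family ?Y \<E>"
      using \<D> \<E> sub by (auto simp: disc_family_def is_disc_def)
    show "meet_in_boundaries ?Y \<D> \<E>"
      using meet sub by (simp add: meet_in_boundaries_def)
  qed
  also have "boundary_curves ?Y \<D> = boundary_curves X \<D>"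
    using sub by (simp add: boundary_curves_def)
  also have "boundary_curves ?Y \<E> = boundary_curves X \<E>"
    using sub by (simp add: boundary_curves_def)
  also have "?Y closure_of (sym_diff (boundary_curves X \<D>) (boundary_curves X \<E>)) =
      X closure_of (sym_diff (boundary_curves X \<D>) (boundary_curves X \<E>))" (is "_ = X closure_of ?Q")
  proof -
    have Q: "?Q \<subseteq> ?U"
      using boundary_curves_subset[of X \<D>] boundary_curves_subset[of X \<E>] by blast
    then have "X closure_of ?Q \<subseteq> ?U"
      using closed by (rule closure_of_minimal)
    then show ?thesis
      using Q by (auto simp: closure_of_subtopology inf.absorb2)
  qed
  finally show ?thesis .
qed

text \<open>
  Replacing \<open>P\<close> by its closure adds only points in which two circles meet, the corners of a ribbon
  graph, and the closure of the symmetric difference with \<open>R\<close> does not see them. One inclusion is general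
  topology, since \<open>R\<close> is closed. For the other, the danger is such a point \<open>x\<close> on a circle of \<open>R\<close> near
  which \<open>R\<close> and the closure of \<open>P\<close> coincide. It lies on the circles of one disc \<open>D\<close> of \<open>\<D>\<close>
  and one disc \<open>E\<close> of \<open>\<A>\<close>, and near \<open>x\<close> the circle of \<open>D\<close> is contained in the circle of \<open>E\<close>. By
  invariance of domain the two circles then agree near \<open>x\<close>, so that \<open>P\<close> is empty there, although
  \<open>x\<close> is in its closure.
\<close>

lemma closure_sym_diff_boundary_curves:
  assumes X: "Hausdorff_space X"
    and \<D>: "disc_family X \<D>" and \<E>: "disc_family X \<E>"
    and sub: "\<A> \<subseteq> \<E>" "\<B> \<subseteq> \<E>"
  defines "P \<equiv> sym_diff (boundary_curves X \<D>) (boundary_curves X \<A>)"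
  defines "R \<equiv> boundary_curves X \<B>"
  shows "X closure_of (sym_diff (X closure_of P) R) = X closure_of (sym_diff P R)"
proof
  have closed: "closedin X (boundary_curves X \<D>)" "closedin X (boundary_curves X \<A>)" "closedin X R"
    unfolding R_def using X \<D> \<E> sub
    by (auto intro!: closedin_boundary_curves intro: disc_family_subset)
  have Psub: "P \<subseteq> boundary_curves X \<D> \<union> boundary_curves X \<A>"
    unfolding P_def by blast
  have clP: "X closure_of P \<subseteq> boundary_curves X \<D> \<union> boundary_curves X \<A>"
    using Psub closed by (intro closure_of_minimal) auto
  have topP: "P \<subseteq> topspace X"
    using Psub closed closedin_subset by blast
  then have PclP: "P \<subseteq> X closure_of P"
    by (rule closure_of_subset)
  have topQ: "sym_diff P R \<subseteq> topspace X" "sym_diff (X closure_of P) R \<subseteq> topspace X"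
    using topP closedin_subset[OF closed(3)] closure_of_subset_topspace[of X P] by auto
  show "X closure_of (sym_diff (X closure_of P) R) \<subseteq> X closure_of (sym_diff P R)"
  proof (intro closure_of_minimal closedin_closure_of)
    have "X closure_of P - R \<subseteq> X closure_of (P - R)"
    proof
      fix x assume x: "x \<in> X closure_of P - R"
      show "x \<in> X closure_of (P - R)"
        unfolding in_closure_of
      proof (intro conjI allI impI)
        show "x \<in> topspace X"
          using x closure_of_subset_topspace by fast
        fix T assume "x \<in> T \<and> openin X T"
        then have "x \<in> T - R" "openin X (T - R)"
          using x closed(3) by auto
        moreover have "\<forall>T. x \<in> T \<and> openin X T \<longrightarrow> (\<exists>y. y \<in> P \<and> y \<in> T)"
          using x by (simp add: in_closure_of)
        ultimately show "\<exists>y. y \<in> P - R \<and> y \<in> T"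
          by blast
      qed
    qed
    also have "\<dots> \<subseteq> X closure_of (sym_diff P R)"
      by (intro closure_of_mono) blast
    finally show "sym_diff (X closure_of P) R \<subseteq> X closure_of (sym_diff P R)"
      using PclP closure_of_subset[OF topQ(1)] by blast
  qed
  show "X closure_of (sym_diff P R) \<subseteq> X closure_of (sym_diff (X closure_of P) R)"
  proof (intro closure_of_minimal closedin_closure_of subsetI, rule ccontr)
    fix x assume x: "x \<in> sym_diff P R" and notin: "x \<notin> X closure_of (sym_diff (X closure_of P) R)"
    then have "x \<notin> sym_diff (X closure_of P) R"
      using closure_of_subset[OF topQ(2)] by blast
    then have xR: "x \<in> R" and xP: "x \<notin> P" and xclP: "x \<in> X closure_of P"
      using x PclP by blast+
    have "x \<in> topspace X"
      using x topQ(1) by blast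
    then obtain T where T: "openin X T" "x \<in> T"
      and "\<nexists>y. y \<in> sym_diff (X closure_of P) R \<and> y \<in> T"
      using notin by (auto simp only: in_closure_of)
    then have TQ: "y \<in> X closure_of P \<longleftrightarrow> y \<in> R" if "y \<in> T" for y
      using that by blast
    have "x \<in> boundary_curves X \<D>" "x \<in> boundary_curves X \<A>"
      using xP xclP clP unfolding P_def by blast+
    then obtain D E where D: "D \<in> \<D>" "x \<in> disc_boundary X D" and E: "E \<in> \<A>" "x \<in> disc_boundary X E"
      by (auto simp: boundary_curves_def)
    have xDE: "x \<in> D" "x \<in> E"
      using D(2) E(2) disc_boundary_subset by fast+
    define Z where "Z = \<Union>(\<D> - {D}) \<union> \<Union>(\<E> - {E})"
    have "closedin X Z"
      unfolding Z_def using X \<D> \<E>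
      by (intro closedin_Un closedin_Union_discs) (auto intro: disc_family_subset)
    moreover have "x \<notin> Z"
      using D(1) E(1) sub xDE disc_family_eq[OF \<D>] disc_family_eq[OF \<E>] unfolding Z_def by blast
    ultimately have O: "openin X (T - Z)" "x \<in> T - Z"
      using T by auto
    have only_D: "y \<in> boundary_curves X \<D> \<longleftrightarrow> y \<in> disc_boundary X D" if "y \<notin> Z" for y
      using boundary_curves_away_from[of y \<D> D X] that D(1) by (simp add: Z_def)
    have only_A: "y \<in> boundary_curves X \<A> \<longleftrightarrow> y \<in> disc_boundary X E" if "y \<notin> Z" for y
      using boundary_curves_away_from[of y \<A> E X] that E(1) sub(1) by (auto simp: Z_def)
    have only_B: "y \<in> R \<Longrightarrow> y \<in> disc_boundary X E" if "y \<notin> Z" for y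
      using boundary_curves_away_from[of y \<B> E X] that sub(2) by (auto simp: Z_def R_def)
    define I where "I = (T - Z) \<inter> disc_boundary X D"
    have "I \<subseteq> disc_boundary X E"
    proof
      fix y assume y: "y \<in> I"
      show "y \<in> disc_boundary X E"
      proof (rule ccontr)
        assume "y \<notin> disc_boundary X E"
        then have "y \<in> P"
          using y only_D only_A unfolding I_def P_def by blast
        then have "y \<in> R"
          using TQ PclP y unfolding I_def by blast
        then show False
          using only_B y \<open>y \<notin> disc_boundary X E\<close> unfolding I_def by blast
      qed
    qed
    moreover have "openin (subtopology X (disc_boundary X D)) I"
      unfolding I_def openin_subtopology using O(1) by blast
    moreover have "is_disc X D" "is_disc X E"
      using \<D> \<E> D(1) E(1) sub by (auto simp: disc_family_def)
    moreover have "I \<subseteq> disc_boundary X D"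
      by (auto simp: I_def)
    ultimately have "openin (subtopology X (disc_boundary X E)) I"
      by (intro disc_boundary_transfer_openin[of X D E])
    then obtain T' where T': "openin X T'" "I = T' \<inter> disc_boundary X E"
      by (auto simp: openin_subtopology)
    have "x \<in> T'"
      using O(2) D(2) T'(2) unfolding I_def by blast
    then have "x \<in> T' \<inter> (T - Z)" "openin X (T' \<inter> (T - Z))"
      using O T'(1) by auto
    moreover have "\<forall>T. x \<in> T \<and> openin X T \<longrightarrow> (\<exists>y. y \<in> P \<and> y \<in> T)"
      using xclP by (simp add: in_closure_of)
    ultimately obtain y where "y \<in> P" "y \<in> T' \<inter> (T - Z)"
      by meson
    then have y: "y \<in> P" "y \<in> T'" "y \<in> T - Z"
      by simp_all
    then have "y \<in> disc_boundary X D \<longleftrightarrow> y \<notin> disc_boundary X E"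
      using only_D only_A unfolding P_def by blast
    then show False
      using y T'(2) unfolding I_def by blast
  qed
qed

section \<open>Attaching discs along their boundaries\<close>

text \<open>
  Finiteness of the set of components makes each of them clopen.
\<close>

lemma finite_components_of_connected_cover:
  assumes "finite \<D>" "topspace X = \<Union>\<D>" and conn: "\<And>D. D \<in> \<D> \<Longrightarrow> connectedin X D"
  shows "finite (connected_components_of X)"
proof -
  have "\<exists>D \<in> \<D>. C = connected_component_of_set X (SOME x. x \<in> D)"
    if C: "C \<in> connected_components_of X" for C
  proof -
    obtain x where x: "x \<in> topspace X" "C = connected_component_of_set X x"
      using C by (auto simp: connected_components_of_def)
    then obtain D where D: "D \<in> \<D>" "x \<in> D"
      using assms(2) by blast
    then have "connected_component_of X x (SOME x. x \<in> D)"
      using conn[OF D(1)] someI[of "\<lambda>x. x \<in> D" x] unfolding connected_component_of_def by blast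
    then show ?thesis
      using x(2) D(1) by (metis connected_component_of_equiv)
  qed
  then have "connected_components_of X \<subseteq> (\<lambda>D. connected_component_of_set X (SOME x. x \<in> D)) ` \<D>"
    by blast
  then show ?thesis
    using assms(1) finite_surj by blast
qed

lemma card_connected_components_of_homeomorphic_map:
  assumes f: "homeomorphic_map X Y f"
  shows "card (connected_components_of Y) = card (connected_components_of X)"
proof -
  have "inj_on ((`) f) (connected_components_of X)"
  proof (rule inj_onI)
    fix C C' assume "C \<in> connected_components_of X" "C' \<in> connected_components_of X" "f ` C = f ` C'"
    then show "C = C'"
      using inj_on_image_eq_iff[OF homeomorphic_imp_injective_map[OF f]] connected_components_of_subset
      by metis
  qed
  then show ?thesis
    using homeomorphic_map_connected_components_of[OF f] card_image by metis
qed

text \<open>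
  A disc attached along its whole boundary circle cannot join two components, because the circle is
  connected. The component \<open>K\<close> of \<open>x\<close> in \<open>Y\<close> is clopen. Adding to \<open>K\<close> and to \<open>Y - K\<close> the discs that are
  attached to them gives a separation of the whole space.
\<close>

lemma connected_component_of_attached_discs:
  assumes X: "Hausdorff_space X" "topspace X = Y \<union> \<Union>\<D>" and \<D>: "disc_family X \<D>"
    and Y: "closedin X Y" and fin: "finite (connected_components_of (subtopology X Y))"
    and attach: "\<And>D. D \<in> \<D> \<Longrightarrow> D \<inter> Y = disc_boundary X D"
    and x: "x \<in> Y"
  shows "connected_component_of_set X x \<inter> Y = connected_component_of_set (subtopology X Y) x"
proof
  define Z where "Z = subtopology X Y"
  have topZ: "topspace Z = Y"
    using closedin_subset[OF Y] by (auto simp: Z_def)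
  define K where "K = connected_component_of_set Z x"
  have K: "K \<in> connected_components_of Z"
    using x topZ by (simp add: K_def connected_component_in_connected_components_of)
  have KY: "K \<subseteq> Y"
    using connected_components_of_subset[OF K] topZ by simp
  have xK: "x \<in> K"
    using x topZ by (simp add: K_def connected_component_of_refl)
  have "closedin Z K" "openin Z K"
    using K fin closedin_connected_components_of open_in_finite_connected_components
    by (auto simp: Z_def)
  then have "closedin Z K" "closedin Z (Y - K)"
    using topZ by (metis, metis closedin_diff closedin_topspace)
  then have closedK: "closedin X K" "closedin X (Y - K)"
    using Y closedin_trans_full unfolding Z_def by blast+
  have side: "D \<inter> Y \<subseteq> K \<or> D \<inter> Y \<subseteq> Y - K" if "D \<in> \<D>" for D
  proof -
    have "is_disc X D"
      using that \<D> by (simp add: disc_family_def)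
    then have "connectedin X (D \<inter> Y)"
      using connectedin_disc_boundary(1) attach[OF that] by simp
    then have "connectedin Z (D \<inter> Y)"
      by (simp add: Z_def connectedin_subtopology)
    then show ?thesis
      using connected_components_of_maximal[OF K, of "D \<inter> Y"] by (auto simp: disjnt_iff)
  qed
  have nonempty: "D \<inter> Y \<noteq> {}" if "D \<in> \<D>" for D
  proof -
    have "is_disc X D"
      using that \<D> by (simp add: disc_family_def)
    from connectedin_disc_boundary(2)[OF this] show ?thesis
      using attach[OF that] by simp
  qed
  define M where "M = K \<union> \<Union>{D \<in> \<D>. D \<inter> Y \<subseteq> K}"
  define N where "N = (Y - K) \<union> \<Union>{D \<in> \<D>. D \<inter> Y \<subseteq> Y - K}"
  have sub: "disc_family X {D \<in> \<D>. D \<inter> Y \<subseteq> K}" "disc_family X {D \<in> \<D>. D \<inter> Y \<subseteq> Y - K}"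
    by (rule disc_family_subset[OF \<D>]; blast)+
  have closed: "closedin X M" "closedin X N"
    unfolding M_def N_def using closedK closedin_Union_discs[OF X(1)] sub by blast+
  have MN: "topspace X \<subseteq> M \<union> N"
  proof
    fix y assume "y \<in> topspace X"
    then consider "y \<in> Y" | D where "D \<in> \<D>" "y \<in> D"
      using X(2) by blast
    then show "y \<in> M \<union> N"
    proof cases
      case 2
      then show ?thesis
        using side[OF 2(1)] unfolding M_def N_def by blast
    qed (auto simp: M_def N_def)
  qed
  have disj: "M \<inter> N = {}"
  proof -
    have False if y: "y \<in> M" "y \<in> N" for y
    proof (cases "y \<in> Y")
      case True
      then show False
        using y by (auto simp: M_def N_def)
    next
      case False
      then obtain D E where D: "D \<in> \<D>" "y \<in> D" "D \<inter> Y \<subseteq> K" and E: "E \<in> \<D>" "y \<in> E" "E \<inter> Y \<subseteq> Y - K"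
        using y KY by (auto simp: M_def N_def)
      then have "D = E"
        using disc_family_eq[OF \<D>] by blast
      then show False
        using nonempty[OF D(1)] D(3) E(3) by blast
    qed
    then show ?thesis
      by blast
  qed
  let ?C = "connected_component_of_set X x"
  have "?C \<subseteq> M \<union> N"
    using MN connected_component_of_subset_topspace[of X x] by blast
  moreover have "x \<in> M \<inter> ?C"
    using x xK X(2) by (simp add: M_def connected_component_of_refl)
  ultimately have "N \<inter> ?C = {}"
    using connectedin_connected_component_of[of X x] closed disj unfolding connectedin_closedin
    by (metis Int_empty_left empty_iff)
  then have "?C \<inter> Y \<subseteq> K"
    by (auto simp: N_def)
  then show "?C \<inter> Y \<subseteq> connected_component_of_set (subtopology X Y) x"
    by (simp add: K_def Z_def)
  have "connectedin X K"
    using connectedin_connected_components_of[OF K] by (simp add: Z_def connectedin_subtopology)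
  then have "K \<subseteq> ?C"
    using xK by (rule connected_component_of_maximal)
  then show "connected_component_of_set (subtopology X Y) x \<subseteq> ?C \<inter> Y"
    using KY by (simp add: K_def Z_def)
qed

text \<open>
  Every component of the whole space meets \<open>Y\<close>, since every attached disc has points on its boundary,
  and it does so in exactly one component of \<open>Y\<close>.
\<close>

lemma card_components_attached_discs:
  assumes X: "Hausdorff_space X" "topspace X = Y \<union> \<Union>\<D>" and \<D>: "disc_family X \<D>"
    and Y: "closedin X Y" and fin: "finite (connected_components_of (subtopology X Y))"
    and attach: "\<And>D. D \<in> \<D> \<Longrightarrow> D \<inter> Y = disc_boundary X D"
  shows "card (connected_components_of X) = card (connected_components_of (subtopology X Y))"
proof -
  let ?C = "connected_component_of_set X"
  have topY: "topspace (subtopology X Y) = Y"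
    using closedin_subset[OF Y] by auto
  have cut: "?C x \<inter> Y = connected_component_of_set (subtopology X Y) x" if "x \<in> Y" for x
    using connected_component_of_attached_discs[OF assms that] .
  have meets: "\<exists>y \<in> Y. ?C x = ?C y" if x: "x \<in> topspace X" for x
  proof (cases "x \<in> Y")
    case False
    then obtain D where D: "D \<in> \<D>" "x \<in> D"
      using x X(2) by blast
    then have disc: "is_disc X D"
      using \<D> by (simp add: disc_family_def)
    then obtain y where "y \<in> D \<inter> Y"
      using connectedin_disc_boundary(2) attach[OF D(1)] by (metis ex_in_conv)
    then have "connected_component_of X x y" "y \<in> Y"
      using connectedin_disc[OF disc] D(2) unfolding connected_component_of_def by blast+
    then show ?thesis
      by (metis connected_component_of_equiv)
  qed blast
  have comps: "connected_components_of X = ?C ` Y"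
  proof
    show "connected_components_of X \<subseteq> ?C ` Y"
      using meets unfolding connected_components_of_def by blast
    show "?C ` Y \<subseteq> connected_components_of X"
      using X(2) unfolding connected_components_of_def by blast
  qed
  have "inj_on (\<lambda>C. C \<inter> Y) (connected_components_of X)"
  proof (rule inj_onI)
    fix C C' assume C: "C \<in> connected_components_of X" "C' \<in> connected_components_of X" "C \<inter> Y = C' \<inter> Y"
    then obtain x where "x \<in> Y" "C = ?C x"
      unfolding comps by blast
    then have "x \<in> C \<inter> Y"
      using X(2) by (simp add: connected_component_of_refl)
    then have "C \<inter> C' \<noteq> {}"
      using C(3) by blast
    then show "C = C'"
      using connected_components_of_overlap[OF C(1,2)] by blast
  qed
  moreover have "(\<lambda>C. C \<inter> Y) ` connected_components_of X = connected_components_of (subtopology X Y)"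
    unfolding comps image_image connected_components_of_def[of "subtopology X Y"] topY
    using cut by (intro image_cong) auto
  ultimately show ?thesis
    by (metis card_image)
qed

section \<open>Ribbon graphs and partial duals\<close>

text \<open>
  The facts about ribbon graphs on which the rest is based. A vertex and a band meet only in
  boundary points of both: a common point is on some segment of attachment, this segment is on the
  boundary of some vertex and of some band, and disjointness leaves only the given ones.
\<close>

lemma ribbon_graph_disc_families:
  assumes "ribbon_graph G"
  shows "disc_family (surf G) (verts G)" "disc_family (surf G) (band G ` edges G)"
    "inj_on (band G) (edges G)" "meet_in_boundaries (surf G) (verts G) (band G ` edges G)"
    "topspace (surf G) = \<Union>(verts G) \<union> \<Union>(band G ` edges G)"
proof -
  show V: "disc_family (surf G) (verts G)" and top: "topspace (surf G) = \<Union>(verts G) \<union> \<Union>(band G ` edges G)"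
    using assms by (auto simp: ribbon_graph_def disc_family_def)
  have disj: "band G e \<inter> band G e' = {}" if "e \<in> edges G" "e' \<in> edges G" "e \<noteq> e'" for e e'
    using assms that by (auto simp: ribbon_graph_def disjoint_family_on_def)
  have disc: "is_disc (surf G) (band G e)" if "e \<in> edges G" for e
    using assms that by (auto simp: ribbon_graph_def)
  have "band G e \<noteq> {}" if e: "e \<in> edges G" for e
  proof -
    obtain x where "x \<in> disc_boundary (surf G) (band G e)"
      using connectedin_disc_boundary(2)[OF disc[OF e]] by (auto simp: ex_in_conv[symmetric])
    from subsetD[OF disc_boundary_subset this] show ?thesis
      by auto
  qed
  then show "inj_on (band G) (edges G)"
    using disj unfolding inj_on_def by (metis inf.idem)
  show E: "disc_family (surf G) (band G ` edges G)"
    using assms disj disc by (auto simp: ribbon_graph_def disc_family_def pairwise_def disjnt_def)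
  obtain L where L: "\<Union>(verts G) \<inter> \<Union>(band G ` edges G) = \<Union>L"
    and Lsides: "\<forall>l \<in> L. is_segment (surf G) l \<and>
      (\<exists>!v. v \<in> verts G \<and> l \<subseteq> disc_boundary (surf G) v) \<and>
      (\<exists>!e. e \<in> edges G \<and> l \<subseteq> disc_boundary (surf G) (band G e))"
    using assms unfolding ribbon_graph_def by (elim conjE exE)
  have LV: "\<exists>v. v \<in> verts G \<and> l \<subseteq> disc_boundary (surf G) v"
    and LE: "\<exists>e. e \<in> edges G \<and> l \<subseteq> disc_boundary (surf G) (band G e)" if "l \<in> L" for l
    using bspec[OF Lsides that] by (simp_all only: ex1_implies_ex)
  show "meet_in_boundaries (surf G) (verts G) (band G ` edges G)"
    unfolding meet_in_boundaries_def
  proof (intro ballI subsetI)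
    fix v b x assume v: "v \<in> verts G" and b: "b \<in> band G ` edges G" and x: "x \<in> v \<inter> b"
    then obtain l where l: "l \<in> L" "x \<in> l"
      using L by blast
    obtain v' where v': "v' \<in> verts G" "x \<in> disc_boundary (surf G) v'"
      using LV[OF l(1)] l(2) by blast
    obtain e where e: "e \<in> edges G" "x \<in> disc_boundary (surf G) (band G e)"
      using LE[OF l(1)] l(2) by blast
    have "v' = v"
      using disc_family_eq[OF V v'(1) v subsetD[OF disc_boundary_subset v'(2)]] x by blast
    moreover have "band G e = b"
      using disc_family_eq[OF E imageI[OF e(1)] b subsetD[OF disc_boundary_subset e(2)]] x by blast
    ultimately show "x \<in> disc_boundary (surf G) v \<inter> disc_boundary (surf G) b"
      using v'(2) e(2) by blast
  qed
qed

lemma disc_family_embedding: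
  assumes i: "embedding_map X S i" and \<D>: "disc_family X \<D>"
  shows "disc_family S ((`) i ` \<D>)"
proof -
  have inj: "inj_on i (topspace X)"
    using i homeomorphic_imp_injective_map unfolding embedding_map_def by blast
  have "i ` D \<inter> i ` E = {}" if "D \<in> \<D>" "E \<in> \<D>" "i ` D \<noteq> i ` E" for D E
  proof -
    have "D \<noteq> E"
      using that(3) by blast
    then have "D \<subseteq> topspace X" "E \<subseteq> topspace X" "D \<inter> E = {}"
      using \<D> that(1,2) by (simp_all add: disc_family_def is_disc_def pairwise_def disjnt_def)
    then show ?thesis
      using inj_on_image_Int[OF inj, of D E] by simp
  qed
  then show ?thesis
    using \<D> is_disc_embedding[OF i] by (auto simp: disc_family_def pairwise_def disjnt_def)
qed

lemma meet_in_boundaries_embedding: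
  assumes i: "embedding_map X S i" and \<D>: "disc_family X \<D>" and \<E>: "disc_family X \<E>"
    and meet: "meet_in_boundaries X \<D> \<E>"
  shows "meet_in_boundaries S ((`) i ` \<D>) ((`) i ` \<E>)"
proof -
  have inj: "inj_on i (topspace X)"
    using i homeomorphic_imp_injective_map unfolding embedding_map_def by blast
  have "i ` D \<inter> i ` E \<subseteq> disc_boundary S (i ` D) \<inter> disc_boundary S (i ` E)"
    if "D \<in> \<D>" "E \<in> \<E>" for D E
  proof -
    have sub: "D \<subseteq> topspace X" "E \<subseteq> topspace X"
      using \<D> \<E> that by (auto simp: disc_family_def is_disc_def)
    have "i ` D \<inter> i ` E = i ` (D \<inter> E)"
      using inj_on_image_Int[OF inj sub] by simp
    also have "D \<inter> E \<subseteq> disc_boundary X D \<inter> disc_boundary X E"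
      using meet that by (auto simp: meet_in_boundaries_def)
    finally show ?thesis
      using disc_boundary_embedding[OF i] sub by blast
  qed
  then show ?thesis
    by (auto simp: meet_in_boundaries_def)
qed

lemma surf_spanning_subgraph:
  "surf (spanning_subgraph G B) = subtopology (surf G) (\<Union>(verts G) \<union> \<Union>(band G ` B))"
  by (simp add: spanning_subgraph_def)

text \<open>
  The boundary of a spanning ribbon subgraph, read off in a space \<open>S\<close> that contains the surface. Since
  the formula only involves circles in \<open>S\<close>, it allows to compare a ribbon graph with its partial dual.
\<close>

lemma spanning_subgraph_boundary_embedded:
  assumes G: "ribbon_graph G" and S: "Hausdorff_space S" and i: "embedding_map (surf G) S i"
    and B: "B \<subseteq> edges G"
  shows "i ` surface_boundary (surf (spanning_subgraph G B)) =
    S closure_of (sym_diff (boundary_curves S ((`) i ` verts G)) (boundary_curves S ((\<lambda>e. i ` band G e) ` B)))"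
proof -
  note fam = ribbon_graph_disc_families[OF G]
  let ?U = "\<Union>(verts G) \<union> \<Union>(band G ` B)"
  have U: "?U \<subseteq> topspace (surf G)"
    using fam(5) B by blast
  have EB: "disc_family (surf G) (band G ` B)"
    using fam(2) B by (intro disc_family_subset[OF fam(2)]) blast
  have meet: "meet_in_boundaries (surf G) (verts G) (band G ` B)"
    using fam(4) B unfolding meet_in_boundaries_def by blast
  have img: "(\<lambda>e. i ` band G e) ` B = (`) i ` band G ` B"
    by (simp add: image_image)
  have "i ` ?U = \<Union>((`) i ` verts G) \<union> \<Union>((`) i ` band G ` B)"
    by blast
  then have "i ` surface_boundary (surf (spanning_subgraph G B)) =
      surface_boundary (subtopology S (\<Union>((`) i ` verts G) \<union> \<Union>((`) i ` band G ` B)))"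
    using disc_boundary_embedding[OF i U] by (simp add: surf_spanning_subgraph)
  also have "\<dots> = S closure_of (sym_diff (boundary_curves S ((`) i ` verts G)) (boundary_curves S ((`) i ` band G ` B)))"
    using S disc_family_embedding[OF i fam(1)] disc_family_embedding[OF i EB]
      meet_in_boundaries_embedding[OF i fam(1) EB meet]
    by (rule surface_boundary_discs)
  finally show ?thesis
    by (simp only: img)
qed

lemma num_boundary_embedded:
  assumes G: "ribbon_graph G" and i: "embedding_map (surf G) S i" and B: "B \<subseteq> edges G"
  shows "num_boundary G B =
    card (connected_components_of (subtopology S (i ` surface_boundary (surf (spanning_subgraph G B)))))"
proof -
  let ?U = "\<Union>(verts G) \<union> \<Union>(band G ` B)" and ?F = "surface_boundary (surf (spanning_subgraph G B))"
  have FU: "?F \<subseteq> ?U"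
    unfolding surf_spanning_subgraph by (rule disc_boundary_subset)
  then have F: "?F \<subseteq> topspace (surf G)"
    using ribbon_graph_disc_families(5)[OF G] B by blast
  have "subtopology (surf (spanning_subgraph G B)) ?F = subtopology (surf G) ?F"
    using FU by (simp add: surf_spanning_subgraph subtopology_subtopology inf.absorb2)
  then have "num_boundary G B = card (connected_components_of (subtopology (surf G) ?F))"
    by (simp add: num_boundary_def boundary_components_def)
  then show ?thesis
    using card_connected_components_of_homeomorphic_map[OF embedding_map_subtopology[OF i F]] by simp
qed

text \<open>
  Applied with \<open>S\<close> being the surface of the partial dual construction, this holds both for the ribbon
  graph and for its partial dual: \<open>S\<close> arises from each of them by attaching the vertices of the other.
\<close>

lemma num_components_embedded:
  assumes G: "ribbon_graph G" and S: "Hausdorff_space S" and i: "embedding_map (surf G) S i"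
    and top: "topspace S = i ` topspace (surf G) \<union> \<Union>\<D>" and \<D>: "disc_family S \<D>"
    and attach: "\<And>D. D \<in> \<D> \<Longrightarrow> D \<inter> i ` topspace (surf G) = disc_boundary S D"
  shows "num_components G = card (connected_components_of S)"
proof -
  note fam = ribbon_graph_disc_families[OF G]
  let ?Y = "i ` topspace (surf G)"
  have hom: "homeomorphic_map (surf G) (subtopology S ?Y) i"
    using i by (simp add: embedding_map_def)
  have Y: "?Y = \<Union>((`) i ` verts G) \<union> \<Union>((`) i ` band G ` edges G)"
    unfolding fam(5) by blast
  have closed: "closedin S ?Y"
    unfolding Y
    by (intro closedin_Un closedin_Union_discs[OF S] disc_family_embedding[OF i] fam)
  have "finite (connected_components_of (surf G))"
  proof (rule finite_components_of_connected_cover)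
    show "finite (verts G \<union> band G ` edges G)"
      using fam(1,2) by (simp add: disc_family_def)
    show "topspace (surf G) = \<Union>(verts G \<union> band G ` edges G)"
      using fam(5) by simp
    fix D assume "D \<in> verts G \<union> band G ` edges G"
    then have "is_disc (surf G) D"
      using fam(1,2) by (auto simp: disc_family_def)
    then show "connectedin (surf G) D"
      by (rule connectedin_disc)
  qed
  then have "finite (connected_components_of (subtopology S ?Y))"
    unfolding homeomorphic_map_connected_components_of[OF hom] by simp
  then have "card (connected_components_of S) = card (connected_components_of (subtopology S ?Y))"
    using card_components_attached_discs[OF S top \<D> closed] attach by blast
  then show ?thesis
    using card_connected_components_of_homeomorphic_map[OF hom] by (simp add: num_components_def)
qed

text \<open>
  In the common space \<open>S\<close>, let \<open>v\<close> be the union of the vertex circles of \<open>G\<close> and \<open>e B\<close> the union of the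
  circles of the bands in \<open>B\<close>. The vertex circles of \<open>H\<close> form the boundary of the spanning subgraph of
  \<open>G\<close> with edge set \<open>A\<close>, hence the closure of the symmetric difference of \<open>v\<close> and \<open>e A\<close>. Thus the boundary
  of the spanning subgraph of \<open>H\<close> with edge set \<open>B\<close> is, up to closures, the symmetric difference of \<open>v\<close>,
  \<open>e A\<close> and \<open>e B\<close>, which is the boundary of the spanning subgraph of \<open>G\<close> for the symmetric difference
  of \<open>A\<close> and \<open>B\<close>. The two boundaries are the same subset of \<open>S\<close>.
\<close>

lemma partial_dual_invariants:
  assumes G: "ribbon_graph G" and A: "A \<subseteq> edges G" and dual: "partial_dual G A H"
  shows "edges H = edges G" "num_components H = num_components G"
    "\<And>B. B \<subseteq> edges G \<Longrightarrow> num_boundary H B = num_boundary G (sym_diff A B)"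
proof -
  define \<C> where "\<C> = boundary_components (spanning_subgraph G A)"
  have H: "ribbon_graph H"
    using dual by (simp add: partial_dual_def)
  show EH: "edges H = edges G"
    using dual by (simp add: partial_dual_def)
  obtain S :: "('a + 'c) topology" and i j d where S: "Hausdorff_space S"
    and i: "embedding_map (surf G) S i"
    and topS: "topspace S = i ` topspace (surf G) \<union> \<Union>(d ` \<C>)"
    and dC: "\<forall>C \<in> \<C>. is_disc S (d C) \<and> disc_boundary S (d C) = i ` C \<and>
      d C \<inter> i ` topspace (surf G) = i ` C"
    and j: "embedding_map (surf H) S j"
    and jH: "j ` topspace (surf H) = topspace S - i ` (\<Union>v \<in> verts G. disc_interior (surf G) v)"
    and jV: "(`) j ` verts H = d ` \<C>"
    and jE: "\<forall>e \<in> edges G. j ` band H e = i ` band G e"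
    using dual unfolding partial_dual_def Let_def \<C>_def[symmetric] by (elim conjE exE)
  have d: "disc_boundary S (d C) = i ` C" "d C \<inter> i ` topspace (surf G) = i ` C" if "C \<in> \<C>" for C
    using dC that by simp_all
  note famG = ribbon_graph_disc_families[OF G] and famH = ribbon_graph_disc_families[OF H]
  have V: "disc_family S ((`) i ` verts G)" and W: "disc_family S (d ` \<C>)"
    using disc_family_embedding[OF i famG(1)] disc_family_embedding[OF j famH(1)] jV by simp_all
  define \<E> where "\<E> B = (\<lambda>e. i ` band G e) ` B" for B
  have \<E>: "disc_family S (\<E> (edges G))"
    using disc_family_embedding[OF i famG(2)] by (simp add: \<E>_def image_image)
  have injE: "inj_on (\<lambda>e. i ` band G e) (edges G)"
  proof (rule inj_onI)
    fix e e' assume e: "e \<in> edges G" "e' \<in> edges G" "i ` band G e = i ` band G e'"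
    moreover have "band G e \<subseteq> topspace (surf G)" "band G e' \<subseteq> topspace (surf G)"
      using e famG(5) by blast+
    moreover have "inj_on i (topspace (surf G))"
      using i homeomorphic_imp_injective_map unfolding embedding_map_def by blast
    ultimately have "band G e = band G e'"
      using inj_on_image_eq_iff by metis
    then show "e = e'"
      using famG(3) e(1,2) by (auto dest: inj_onD)
  qed
  have W_curves: "boundary_curves S (d ` \<C>) =
      S closure_of (sym_diff (boundary_curves S ((`) i ` verts G)) (boundary_curves S (\<E> A)))"
  proof -
    let ?F = "surface_boundary (surf (spanning_subgraph G A))"
    have "boundary_curves S (d ` \<C>) = i ` \<Union>\<C>"
      unfolding boundary_curves_def using d(1) by (simp add: image_Union)
    also have "\<Union>\<C> = ?F"
      using surface_boundary_subset[of "surf (spanning_subgraph G A)"]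
      by (simp add: \<C>_def boundary_components_def Union_connected_components_of inf.absorb2)
    finally show ?thesis
      using spanning_subgraph_boundary_embedded[OF G S i A] by (simp add: \<E>_def)
  qed
  show "num_boundary H B = num_boundary G (sym_diff A B)" if B: "B \<subseteq> edges G" for B
  proof -
    have AB: "sym_diff A B \<subseteq> edges G"
      using A B by blast
    have "(\<lambda>e. j ` band H e) ` B = \<E> B"
      using jE B unfolding \<E>_def by (intro image_cong) auto
    then have "j ` surface_boundary (surf (spanning_subgraph H B)) =
        S closure_of (sym_diff (boundary_curves S (d ` \<C>)) (boundary_curves S (\<E> B)))"
      using spanning_subgraph_boundary_embedded[OF H S j] B EH jV by simp
    also have "\<dots> = S closure_of (sym_diff (sym_diff (boundary_curves S ((`) i ` verts G))
        (boundary_curves S (\<E> A))) (boundary_curves S (\<E> B)))"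
      unfolding W_curves
      by (rule closure_sym_diff_boundary_curves[OF S V \<E>]) (use A B in \<open>auto simp: \<E>_def\<close>)
    also have "sym_diff (sym_diff (boundary_curves S ((`) i ` verts G)) (boundary_curves S (\<E> A)))
        (boundary_curves S (\<E> B)) = sym_diff (boundary_curves S ((`) i ` verts G))
          (sym_diff (boundary_curves S (\<E> A)) (boundary_curves S (\<E> B)))"
      by blast
    also have "sym_diff (boundary_curves S (\<E> A)) (boundary_curves S (\<E> B)) =
        boundary_curves S (sym_diff (\<E> A) (\<E> B))"
      by (rule boundary_curves_sym_diff[OF \<E>, symmetric]) (use A B in \<open>auto simp: \<E>_def\<close>)
    also have "sym_diff (\<E> A) (\<E> B) = \<E> (sym_diff A B)"
      unfolding \<E>_def using inj_on_image_set_diff[OF injE, of A B] inj_on_image_set_diff[OF injE, of B A] A B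
      by (simp add: image_Un Diff_subset subset_trans[OF Diff_subset])
    also have "S closure_of (sym_diff (boundary_curves S ((`) i ` verts G)) (boundary_curves S (\<E> (sym_diff A B)))) =
        i ` surface_boundary (surf (spanning_subgraph G (sym_diff A B)))"
      using spanning_subgraph_boundary_embedded[OF G S i AB] by (simp add: \<E>_def)
    finally show ?thesis
      using num_boundary_embedded[OF G i AB] num_boundary_embedded[OF H j, of B] B EH by simp
  qed
  have "num_components G = card (connected_components_of S)"
  proof (rule num_components_embedded[OF G S i topS W])
    fix D assume "D \<in> d ` \<C>"
    then show "D \<inter> i ` topspace (surf G) = disc_boundary S D"
      using d by (elim imageE) simp
  qed
  moreover have "num_components H = card (connected_components_of S)"
  proof (rule num_components_embedded[OF H S j _ V])
    have inj: "inj_on i (topspace (surf G))"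
      using i homeomorphic_imp_injective_map unfolding embedding_map_def by blast
    have vtop: "v \<subseteq> topspace (surf G)" if "v \<in> verts G" for v
      using that famG(5) by blast
    have iv: "i ` v \<subseteq> topspace S" if "v \<in> verts G" for v
      using vtop[OF that] topS by blast
    have int: "disc_interior (surf G) v \<subseteq> v" for v
      by (auto simp: disc_interior_def)
    show "topspace S = j ` topspace (surf H) \<union> \<Union>((`) i ` verts G)"
    proof -
      have "\<Union>((`) i ` verts G) \<subseteq> topspace S"
        using iv by blast
      moreover have "i ` (\<Union>v \<in> verts G. disc_interior (surf G) v) \<subseteq> \<Union>((`) i ` verts G)"
      proof -
        have "(\<Union>v \<in> verts G. disc_interior (surf G) v) \<subseteq> (\<Union>v \<in> verts G. v)"
          by (rule UN_mono[OF order_refl int])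
        from image_mono[OF this, of i] show ?thesis
          by (simp add: image_Union)
      qed
      moreover have "X = (X - J) \<union> U" if "U \<subseteq> X" "J \<subseteq> U" for X J U :: "('a + 'c) set"
        using that by blast
      ultimately show ?thesis
        unfolding jH by metis
    qed
    fix D assume "D \<in> (`) i ` verts G"
    then obtain v where v: "v \<in> verts G" "D = i ` v"
      by blast
    let ?I = "\<Union>v \<in> verts G. disc_interior (surf G) v"
    have "x \<in> disc_interior (surf G) v" if x: "x \<in> v" "u \<in> verts G" "x \<in> disc_interior (surf G) u" for x u
    proof -
      have "u = v"
        using disc_family_eq[OF famG(1) x(2) v(1) subsetD[OF int x(3)] x(1)] .
      then show ?thesis
        using x(3) by simp
    qed
    then have "v - ?I = v - disc_interior (surf G) v"
      using v(1) by blast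
    also have "\<dots> = disc_boundary (surf G) v"
      using disc_boundary_subset[of "surf G" v] by (auto simp: disc_interior_def)
    finally have "v - ?I = disc_boundary (surf G) v" .
    moreover have "D \<inter> j ` topspace (surf H) = i ` (v - ?I)"
    proof -
      have "?I \<subseteq> topspace (surf G)"
        using int vtop by blast
      moreover have "v - ?I \<subseteq> topspace (surf G)"
        using vtop[OF v(1)] by blast
      ultimately have "i ` (v - ?I) = i ` v - i ` ?I"
        using inj_on_image_set_diff[OF inj] by simp
      moreover have "U \<inter> (X - J) = U - J" if "U \<subseteq> X" for X J U :: "('a + 'c) set"
        using that by blast
      ultimately show ?thesis
        unfolding jH v(2) using iv[OF v(1)] by simp
    qed
    ultimately show "D \<inter> j ` topspace (surf H) = disc_boundary S D"
      using disc_boundary_embedding[OF i vtop[OF v(1)]] v(2) by simp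
  qed
  ultimately show "num_components H = num_components G"
    by simp
qed

text \<open>
  The symmetric difference with \<open>A\<close> is an involution, so twisting a set system amounts to
  substituting it in the condition for feasible sets.
\<close>

lemma sym_diff_eq_twist:
  assumes A: "A \<subseteq> E" and PQ: "\<And>B. B \<subseteq> E \<Longrightarrow> Q B \<longleftrightarrow> P (sym_diff A B)"
  shows "(E, {B. B \<subseteq> E \<and> Q B}) = twist (E, {B. B \<subseteq> E \<and> P B}) A"
proof -
  have cancel: "sym_diff A (sym_diff A B) = B" for B
    by blast
  have closed: "sym_diff A B \<subseteq> E" if "B \<subseteq> E" for B
    using A that by blast
  have "{B. B \<subseteq> E \<and> Q B} = {sym_diff A X |X. X \<in> {B. B \<subseteq> E \<and> P B}}" (is "?l = ?r")
  proof (intro equalityI subsetI)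
    fix B assume B: "B \<in> ?l"
    then have "sym_diff A B \<in> {B. B \<subseteq> E \<and> P B}"
      using PQ closed by auto
    then show "B \<in> ?r"
      using cancel[of B] by (metis (mono_tags, lifting) mem_Collect_eq)
  next
    fix B assume "B \<in> ?r"
    then obtain X where X: "B = sym_diff A X" "X \<subseteq> E" "P X"
      by blast
    then show "B \<in> ?l"
      using PQ[of B] closed[of X] cancel[of X] by simp
  qed
  then show ?thesis
    by (simp add: twist_def)
qed

text \<open>
  By the two invariants, the condition for \<open>B\<close> to be feasible for the partial dual is
  the condition for the symmetric difference of \<open>A\<close> and \<open>B\<close> to be feasible for \<open>G\<close>.
\<close>

theorem theorem5p1:
  fixes G :: "('p, 'e) ribbon" and H :: "('q, 'e) ribbon" and A :: "'e set" and k :: nat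
  assumes "ribbon_graph G" and "A \<subseteq> edges G" and "partial_dual G A H"
  shows "D_le k H = twist (D_le k G) A \<and>
         D_ribbon H = twist (D_ribbon G) A \<and>
         (orientable G \<longrightarrow> D_eq 1 H = twist (D_eq 1 G) A)"
proof -
  note inv = partial_dual_invariants[OF assms]
  have "D_le n H = twist (D_le n G) A" for n
    unfolding D_le_def inv(1,2) using assms(2) inv(3) by (intro sym_diff_eq_twist) auto
  moreover have "D_eq n H = twist (D_eq n G) A" for n
    unfolding D_eq_def inv(1,2) using assms(2) inv(3) by (intro sym_diff_eq_twist) auto
  ultimately show ?thesis
    by (simp add: D_ribbon_def)
qed

end
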